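(* In the call-by-value $\lambda$-calculus with shift and reset, the set $\mathcal F=\{\mathrm{refl},\mathrm{lam},\mathrm{subst},\mathrm{pctx},\mathrm{pctxrst},\mathrm{ectxpure},\mathrm{id},\mathrm{red}\}$ of functions on relations is diacritically compatible, and $\mathrm{strong}(\mathcal F)=\mathcal F\setminus\{\mathrm{pctx},\mathrm{pctxrst},\mathrm{ectxpure}\}$.
   Context: Calculus: terms $t,s ::= v\mid t\,s\mid \langle t\rangle$, values $v,w ::= x\mid\lambda x.t\mid \mathcal S$ ($\langle\cdot\rangle$ is reset, the constant $\mathcal S$ is shift; terms modulo $\alpha$-conversion, $t\{v/x\}$ capture-avoiding substitution). Pure terms are values and terms of the form $\langle t\rangle$. Pure contexts $E::=[\,]\mid v\,E\mid E\,t$; evaluation contexts $F::=[\,]\mid v\,F\mid F\,t\mid\langle F\rangle$. Every evaluation context is either pure or uniquely of the form $F[\langle E\rangle]$ with $E$ pure. Reduction: $F[(\lambda x.t)\,v]\to F[t\{v/x\}]$; $F[\langle E[\mathcal S\,v]\rangle]\to F[\langle v\,(\lambda x.\langle E[x]\rangle)\rangle]$ with $x$ not free in $E$; $F[\langle v\rangle]\to F[v]$. $\to^*$ is the reflexive-transitive closure; $t\Downarrow s$ means $t\to^*s$ with $s$ irreducible. A variable is fresh if it does not occur in the terms/contexts under consideration. For a relation $R$ on terms: $v\mathrel{R^v}w$ iff $(v\,x)\mathrel R(w\,x)$ for fresh $x$. For evaluation contexts: if $E,E'$ are pure, $E\mathrel{R^E}E'$ iff $E[x]\mathrel R E'[x]$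 for fresh $x$; and $F[\langle E\rangle]\mathrel{R^E}F'[\langle E'\rangle]$ (with $E,E'$ pure) iff $\langle E[x]\rangle\mathrel R\langle E'[x]\rangle$ and $F[x]\mathrel R F'[x]$ for fresh $x$. $F[x\,v]\mathrel{R^o}F'[x\,w]$ iff $F\mathrel{R^E}F'$ and $v\mathrel{R^v}w$. For pure $E,E'$: $E[\mathcal S\,v]\mathrel{R^c}E'[\mathcal S\,w]$ iff $E\mathrel{R^E}E'$ and $\langle v\,x\rangle\mathrel R\langle w\,x\rangle$ for fresh $x$. Diacritical progress: $R\rightsquigarrow S,T$ iff $R\subseteq S\subseteq T$ and whenever $t\mathrel R s$: (i) if $t\to t'$ then $s\to^*s'$ for some $s'$ with $t'\mathrel T s'$; (ii) if $t=v$ is a value then $s\Downarrow w$ for a value $w$ with $v\mathrel{S^v}w$; (iii) if $t=F[x\,v]$ then $s\Downarrow F'[x\,w]$ with $F[x\,v]\mathrel{T^o}F'[x\,w]$; (iv) if $t=E[\mathcal S\,v]$ with $E$ pure then $s\Downarrow E'[\mathcal S\,w]$ with $E'$ pure and $E[\mathcal S\,v]\mathrel{T^c}E'[\mathcal S\,w]$; (v) the symmetric conditions with $t,s$ exchanged. Functions on relations: $\mathrm{id}(R)=R$; $(f\cup g)(R)=f(R)\cup g(R)$; $(f\circ g)(R)=f(g(R))$; $f^\omega=\bigcup_{n\in\mathbb N}f^n$ ($f^0=\mathrm{id}$); $\hat f=f\cup\mathrm{id}$; a set $\mathcal G$ of functions is identified with $\bigcup_{f\in\mathcal G}f$. $f$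 is continuous if $f(R)\subseteq\bigcup\{f(S)\mid S\subseteq R\text{ finite}\}$. $f$ evolves to $g,h$ if for all $R,T$ with $R\rightsquigarrow R,T$, $f(R)\rightsquigarrow g(R),h(T)$; $f$ strongly evolves to $g,h$ if for all $R,S,T$ with $R\rightsquigarrow S,T$, $f(R)\rightsquigarrow g(S),h(T)$. A set $\mathcal F$ of continuous functions is diacritically compatible if it has a subset $\mathcal S$ such that every $f\in\mathcal S$ strongly evolves to $\hat{\mathcal S}^\omega,\hat{\mathcal F}^\omega$ and every $f\in\mathcal F$ evolves to $\hat{\mathcal S}^\omega\circ\hat{\mathcal F}\circ\hat{\mathcal S}^\omega,\hat{\mathcal F}^\omega$; the union of all such subsets is again such a subset and is denoted $\mathrm{strong}(\mathcal F)$. Specific functions: $\mathrm{refl}(R)=\{(t,t)\}$; $\mathrm{lam}(R)=\{(\lambda x.t,\lambda x.s)\mid t\mathrel Rs\}$; $\mathrm{subst}(R)=\{(t\{v/x\},s\{w/x\})\mid t\mathrel Rs,\ v\mathrel{R^v}w\}$; $\mathrm{red}(R)=\{(t,s)\mid t\to^*t',s\to^*s',t'\mathrel Rs'\}$; $\mathrm{pctx}(R)=\{(E[t],E'[s])\mid t\mathrel Rs,\ E,E'\text{ pure},\ E\mathrel{R^E}E'\}$; $\mathrm{pctxrst}(R)=\{(\langle E[t]\rangle,\langle E'[s]\rangle)\mid t\mathrel Rs,\ E,E'\text{ pure},\ \langle E\rangle\mathrel{R^E}\langle E'\rangle\}$; $\mathrm{ectxpure}(R)=\{(F[t],F'[s])\mid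 t\mathrel Rs,\ t,s\text{ pure},\ F[x]\mathrel R F'[x]\text{ for fresh }x\}$. *)

theory Defs
  imports Main
begin

section \<open>Terms modulo alpha-conversion\<close>

text \<open>
  Terms modulo alpha are represented by de Bruijn terms.  The variable names are the natural
  numbers: outside of all binders, the index \<open>x\<close> is the free variable named \<open>x\<close>; below \<open>n\<close>
  abstractions that variable is the index \<open>x + n\<close>.  The calculus below is written with the named
  abstraction \<open>LAM x t\<close>, and the lemmas of this section show that \<open>LAM\<close> and
  substitution behave as in the named calculus.
\<close>

datatype trm = Val val | App trm trm | Reset trm
  and val = Var nat | Lam trm | Shift

primrec rename :: "(nat \<Rightarrow> nat) \<Rightarrow> trm \<Rightarrow> trm"
  and renamev :: "(nat \<Rightarrow> nat) \<Rightarrow> val \<Rightarrow> val" where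
  "rename r (Val v) = Val (renamev r v)"
| "rename r (App t s) = App (rename r t) (rename r s)"
| "rename r (Reset t) = Reset (rename r t)"
| "renamev r (Var x) = Var (r x)"
| "renamev r (Lam t) = Lam (rename (case_nat 0 (\<lambda>i. Suc (r i))) t)"
| "renamev r Shift = Shift"

primrec psubst :: "(nat \<Rightarrow> val) \<Rightarrow> trm \<Rightarrow> trm"
  and psubstv :: "(nat \<Rightarrow> val) \<Rightarrow> val \<Rightarrow> val" where
  "psubst \<sigma> (Val v) = Val (psubstv \<sigma> v)"
| "psubst \<sigma> (App t s) = App (psubst \<sigma> t) (psubst \<sigma> s)"
| "psubst \<sigma> (Reset t) = Reset (psubst \<sigma> t)"
| "psubstv \<sigma> (Var x) = \<sigma> x"
| "psubstv \<sigma> (Lam t) = Lam (psubst (case_nat (Var 0) (\<lambda>i. renamev Suc (\<sigma> i))) t)"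
| "psubstv \<sigma> Shift = Shift"

primrec fv :: "trm \<Rightarrow> nat set" and fvv :: "val \<Rightarrow> nat set" where
  "fv (Val v) = fvv v"
| "fv (App t s) = fv t \<union> fv s"
| "fv (Reset t) = fv t"
| "fvv (Var x) = {x}"
| "fvv (Lam t) = {x. Suc x \<in> fv t}"
| "fvv Shift = {}"

definition LAM :: "nat \<Rightarrow> trm \<Rightarrow> val" where
  "LAM x t = Lam (rename (\<lambda>y. if y = x then 0 else Suc y) t)"

abbreviation subst1 :: "trm \<Rightarrow> nat \<Rightarrow> val \<Rightarrow> trm" ("_[_::=_]" [1000, 0, 0] 1000) where
  "t[x::=v] \<equiv> psubst (Var(x := v)) t"

abbreviation subst1v :: "val \<Rightarrow> nat \<Rightarrow> val \<Rightarrow> val" where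
  "subst1v w x v \<equiv> psubstv (Var(x := v)) w"

abbreviation tvar :: "nat \<Rightarrow> trm" where
  "tvar x \<equiv> Val (Var x)"

lemma finite_fv: "finite (fv t)" and finite_fvv: "finite (fvv v)"
proof (induct t and v rule: trm.induct val.induct)
  case (Lam t)
  have "{x. Suc x \<in> fv t} = Suc -` fv t" by auto
  with Lam show ?case by (simp add: finite_vimageI)
qed auto

lemma rename_cong: "(\<And>i. i \<in> fv t \<Longrightarrow> r i = q i) \<Longrightarrow> rename r t = rename q t"
  and renamev_cong: "(\<And>i. i \<in> fvv v \<Longrightarrow> r i = q i) \<Longrightarrow> renamev r v = renamev q v"
proof (induct t and v arbitrary: r q and r q rule: trm.induct val.induct)
  case (Lam t)
  have "rename (case_nat 0 (\<lambda>i. Suc (r i))) t = rename (case_nat 0 (\<lambda>i. Suc (q i))) t"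
    by (rule Lam(1)) (auto simp: Lam(2) split: nat.split)
  then show ?case by simp
next
  case (App t s)
  have "rename r t = rename q t" "rename r s = rename q s"
    by (rule App(1), simp add: App(3)) (rule App(2), simp add: App(3))
  then show ?case by simp
next
  case (Val v)
  have "renamev r v = renamev q v"
    by (rule Val(1), simp add: Val(2))
  then show ?case by simp
next
  case (Reset t)
  have "rename r t = rename q t"
    by (rule Reset(1), simp add: Reset(2))
  then show ?case by simp
qed simp_all

lemma psubst_cong: "(\<And>i. i \<in> fv t \<Longrightarrow> \<sigma> i = \<tau> i) \<Longrightarrow> psubst \<sigma> t = psubst \<tau> t"
  and psubstv_cong: "(\<And>i. i \<in> fvv v \<Longrightarrow> \<sigma> i = \<tau> i) \<Longrightarrow> psubstv \<sigma> v = psubstv \<tau> v"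
proof (induct t and v arbitrary: \<sigma> \<tau> and \<sigma> \<tau> rule: trm.induct val.induct)
  case (Lam t)
  have "psubst (case_nat (Var 0) (\<lambda>i. renamev Suc (\<sigma> i))) t
      = psubst (case_nat (Var 0) (\<lambda>i. renamev Suc (\<tau> i))) t"
    by (rule Lam(1)) (auto simp: Lam(2) split: nat.split)
  then show ?case by simp
next
  case (App t s)
  have "psubst \<sigma> t = psubst \<tau> t" "psubst \<sigma> s = psubst \<tau> s"
    by (rule App(1), simp add: App(3)) (rule App(2), simp add: App(3))
  then show ?case by simp
next
  case (Val v)
  have "psubstv \<sigma> v = psubstv \<tau> v"
    by (rule Val(1), simp add: Val(2))
  then show ?case by simp
next
  case (Reset t)
  have "psubst \<sigma> t = psubst \<tau> t"
    by (rule Reset(1), simp add: Reset(2))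
  then show ?case by simp
qed simp_all

lemma rename_rename: "rename r (rename q t) = rename (\<lambda>i. r (q i)) t"
  and renamev_renamev: "renamev r (renamev q v) = renamev (\<lambda>i. r (q i)) v"
proof (induct t and v arbitrary: r q and r q rule: trm.induct val.induct)
  case (Lam t)
  have "(\<lambda>i. case_nat 0 (\<lambda>i. Suc (r i)) (case_nat 0 (\<lambda>i. Suc (q i)) i))
      = case_nat 0 (\<lambda>i. Suc (r (q i)))"
    by (simp add: fun_eq_iff split: nat.split)
  then show ?case by (simp add: Lam)
qed simp_all

lemma psubst_rename: "psubst \<sigma> (rename r t) = psubst (\<lambda>i. \<sigma> (r i)) t"
  and psubstv_renamev: "psubstv \<sigma> (renamev r v) = psubstv (\<lambda>i. \<sigma> (r i)) v"
proof (induct t and v arbitrary: \<sigma> r and \<sigma> r rule: trm.induct val.induct)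
  case (Lam t)
  have "(\<lambda>i. case_nat (Var 0) (\<lambda>i. renamev Suc (\<sigma> i)) (case_nat 0 (\<lambda>i. Suc (r i)) i))
      = case_nat (Var 0) (\<lambda>i. renamev Suc (\<sigma> (r i)))"
    by (simp add: fun_eq_iff split: nat.split)
  then show ?case by (simp add: Lam)
qed simp_all

lemma rename_psubst: "rename r (psubst \<sigma> t) = psubst (\<lambda>i. renamev r (\<sigma> i)) t"
  and renamev_psubstv: "renamev r (psubstv \<sigma> v) = psubstv (\<lambda>i. renamev r (\<sigma> i)) v"
proof (induct t and v arbitrary: \<sigma> r and \<sigma> r rule: trm.induct val.induct)
  case (Lam t)
  have "(\<lambda>i. renamev (case_nat 0 (\<lambda>i. Suc (r i))) (case_nat (Var 0) (\<lambda>i. renamev Suc (\<sigma> i)) i))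
      = case_nat (Var 0) (\<lambda>i. renamev Suc (renamev r (\<sigma> i)))"
    by (simp add: fun_eq_iff renamev_renamev split: nat.split)
  then show ?case by (simp add: Lam)
qed simp_all

lemma psubst_Var: "psubst Var t = t"
  and psubstv_Var: "psubstv Var v = v"
proof (induct t and v rule: trm.induct val.induct)
  case (Lam t)
  have "case_nat (Var 0) (\<lambda>i. Var (Suc i)) = Var"
    by (simp add: fun_eq_iff split: nat.split)
  with Lam show ?case by simp
qed simp_all

lemma rename_eq_psubst: "rename r t = psubst (\<lambda>i. Var (r i)) t"
  using rename_psubst[of r Var t] by (simp add: psubst_Var)

lemma fv_rename: "fv (rename r t) = r ` fv t"
  and fvv_renamev: "fvv (renamev r v) = r ` fvv v"
proof (induct t and v arbitrary: r and r rule: trm.induct val.induct)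
  case (Lam t)
  have "Suc x \<in> case_nat 0 (\<lambda>i. Suc (r i)) ` A \<longleftrightarrow> x \<in> r ` {i. Suc i \<in> A}" for x A
  proof
    assume "Suc x \<in> case_nat 0 (\<lambda>i. Suc (r i)) ` A"
    then obtain i where "i \<in> A" "Suc x = case_nat 0 (\<lambda>i. Suc (r i)) i" by blast
    then show "x \<in> r ` {i. Suc i \<in> A}" by (cases i) auto
  next
    assume "x \<in> r ` {i. Suc i \<in> A}"
    then obtain i where "Suc i \<in> A" "x = r i" by blast
    then show "Suc x \<in> case_nat 0 (\<lambda>i. Suc (r i)) ` A"
      by (intro image_eqI[of _ _ "Suc i"]) simp_all
  qed
  then have "{x. Suc x \<in> case_nat 0 (\<lambda>i. Suc (r i)) ` fv t} = r ` {i. Suc i \<in> fv t}" by blast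
  then show ?case by (simp only: renamev.simps fvv.simps Lam)
qed (simp_all add: image_Un)

lemma fvv_LAM: "fvv (LAM x t) = fv t - {x}"
  by (auto simp: LAM_def fv_rename image_iff split: if_splits)

lemma LAM_alpha:
  assumes "y \<notin> fvv (LAM x t)"
  shows "LAM x t = LAM y (t[x::=Var y])"
proof -
  have "Var (if i = x then 0 else Suc i) =
      renamev (\<lambda>z. if z = y then 0 else Suc z) ((Var(x := Var y)) i)" if "i \<in> fv t" for i
    using assms that by (cases "i = x") (auto simp: fvv_LAM)
  then show ?thesis
    unfolding LAM_def rename_psubst rename_eq_psubst[of _ t]
    by (intro arg_cong[where f = Lam] psubst_cong)
qed

lemma Lam_eq_LAM:
  assumes "x \<notin> fvv (Lam b)"
  shows "Lam b = LAM x (psubst (case_nat (Var x) Var) b)"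
proof -
  have "psubst (\<lambda>i. renamev (\<lambda>y. if y = x then 0 else Suc y) (case_nat (Var x) Var i)) b = psubst Var b"
    using assms by (intro psubst_cong) (auto split: nat.splits)
  then show ?thesis by (simp add: LAM_def rename_psubst psubst_Var)
qed

lemma subst1v_LAM:
  assumes "y \<noteq> x" "y \<notin> fvv v"
  shows "subst1v (LAM y t) x v = LAM y (t[x::=v])"
proof -
  have "renamev Suc v = renamev (\<lambda>z. if z = y then 0 else Suc z) v"
    using assms by (intro renamev_cong) auto
  then show ?thesis
    using assms by (auto simp: LAM_def psubst_rename rename_psubst intro!: psubst_cong)
qed


section \<open>Contexts and reduction\<close>

datatype ctx = Hole | CAppR val ctx | CAppL ctx trm | CReset ctx

primrec plug :: "ctx \<Rightarrow> trm \<Rightarrow> trm" where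
  "plug Hole t = t"
| "plug (CAppR v F) t = App (Val v) (plug F t)"
| "plug (CAppL F s) t = App (plug F t) s"
| "plug (CReset F) t = Reset (plug F t)"

primrec ccomp :: "ctx \<Rightarrow> ctx \<Rightarrow> ctx" where
  "ccomp Hole G = G"
| "ccomp (CAppR v F) G = CAppR v (ccomp F G)"
| "ccomp (CAppL F s) G = CAppL (ccomp F G) s"
| "ccomp (CReset F) G = CReset (ccomp F G)"

primrec fvc :: "ctx \<Rightarrow> nat set" where
  "fvc Hole = {}"
| "fvc (CAppR v F) = fvv v \<union> fvc F"
| "fvc (CAppL F s) = fvc F \<union> fv s"
| "fvc (CReset F) = fvc F"

primrec pure_ctx :: "ctx \<Rightarrow> bool" where
  "pure_ctx Hole = True"
| "pure_ctx (CAppR v F) = pure_ctx F"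
| "pure_ctx (CAppL F s) = pure_ctx F"
| "pure_ctx (CReset F) = False"

definition pure_trm :: "trm \<Rightarrow> bool" where
  "pure_trm t \<longleftrightarrow> (\<exists>v. t = Val v) \<or> (\<exists>s. t = Reset s)"

inductive step :: "trm \<Rightarrow> trm \<Rightarrow> bool" (infix "\<leadsto>" 50) where
  beta: "plug F (App (Val (LAM x t)) (Val v)) \<leadsto> plug F (t[x::=v])"
| shift: "\<lbrakk>pure_ctx E; x \<notin> fvc E\<rbrakk> \<Longrightarrow>
    plug F (Reset (plug E (App (Val Shift) (Val v))))
      \<leadsto> plug F (Reset (App (Val v) (Val (LAM x (Reset (plug E (tvar x)))))))"
| reset: "plug F (Reset (Val v)) \<leadsto> plug F (Val v)"

abbreviation steps :: "trm \<Rightarrow> trm \<Rightarrow> bool" (infix "\<leadsto>*" 50) where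
  "t \<leadsto>* s \<equiv> step\<^sup>*\<^sup>* t s"

definition evaluates :: "trm \<Rightarrow> trm \<Rightarrow> bool" (infix "\<Down>" 50) where
  "t \<Down> s \<longleftrightarrow> t \<leadsto>* s \<and> (\<nexists>s'. s \<leadsto> s')"


section \<open>Diacritical progress\<close>

type_synonym trel = "(trm \<times> trm) set"

text \<open>
  Relations on terms are arbitrary, so they need not be closed under renaming.  Accordingly
  ``for fresh \<open>x\<close>'' is read as ``for some \<open>x\<close> which is fresh''; quantifying over all
  fresh variables instead would relate values because of infinitely many pairs of the relation, and
  the functions built from these extensions would not be continuous.
\<close>

definition val_ext :: "trel \<Rightarrow> (val \<times> val) set" where
  "val_ext R = {(v, w). \<exists>x. x \<notin> fvv v \<union> fvv w \<and>
     (App (Val v) (tvar x), App (Val w) (tvar x)) \<in> R}"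

inductive_set ctx_ext :: "trel \<Rightarrow> (ctx \<times> ctx) set" for R :: trel where
  pure: "\<lbrakk>pure_ctx E; pure_ctx E'; x \<notin> fvc E \<union> fvc E'; (plug E (tvar x), plug E' (tvar x)) \<in> R\<rbrakk>
    \<Longrightarrow> (E, E') \<in> ctx_ext R"
| impure: "\<lbrakk>pure_ctx E; pure_ctx E'; x \<notin> fvc F \<union> fvc E \<union> fvc F' \<union> fvc E';
     (Reset (plug E (tvar x)), Reset (plug E' (tvar x))) \<in> R;
     (plug F (tvar x), plug F' (tvar x)) \<in> R\<rbrakk>
    \<Longrightarrow> (ccomp F (CReset E), ccomp F' (CReset E')) \<in> ctx_ext R"

definition open_ext :: "trel \<Rightarrow> trel" where
  "open_ext R = {(plug F (App (tvar x) (Val v)), plug F' (App (tvar x) (Val w))) | F F' x v w.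
     (F, F') \<in> ctx_ext R \<and> (v, w) \<in> val_ext R}"

definition ctrl_ext :: "trel \<Rightarrow> trel" where
  "ctrl_ext R = {(plug E (App (Val Shift) (Val v)), plug E' (App (Val Shift) (Val w))) | E E' v w.
     pure_ctx E \<and> pure_ctx E' \<and> (E, E') \<in> ctx_ext R \<and>
     (\<exists>x. x \<notin> fvv v \<union> fvv w \<and>
        (Reset (App (Val v) (tvar x)), Reset (App (Val w) (tvar x))) \<in> R)}"

definition half_progress :: "trel \<Rightarrow> trel \<Rightarrow> trel \<Rightarrow> bool" where
  "half_progress R S T \<longleftrightarrow> (\<forall>t s. (t, s) \<in> R \<longrightarrow>
     (\<forall>t'. t \<leadsto> t' \<longrightarrow> (\<exists>s'. s \<leadsto>* s' \<and> (t', s') \<in> T)) \<and>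
     (\<forall>v. t = Val v \<longrightarrow> (\<exists>w. s \<Down> Val w \<and> (v, w) \<in> val_ext S)) \<and>
     (\<forall>F x v. t = plug F (App (tvar x) (Val v)) \<longrightarrow>
        (\<exists>F' w. s \<Down> plug F' (App (tvar x) (Val w)) \<and>
           (t, plug F' (App (tvar x) (Val w))) \<in> open_ext T)) \<and>
     (\<forall>E v. pure_ctx E \<and> t = plug E (App (Val Shift) (Val v)) \<longrightarrow>
        (\<exists>E' w. pure_ctx E' \<and> s \<Down> plug E' (App (Val Shift) (Val w)) \<and>
           (t, plug E' (App (Val Shift) (Val w))) \<in> ctrl_ext T)))"

definition progress :: "trel \<Rightarrow> trel \<Rightarrow> trel \<Rightarrow> bool" where
  "progress R S T \<longleftrightarrow> R \<subseteq> S \<and> S \<subseteq> T \<and>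
     half_progress R S T \<and> half_progress (R\<inverse>) (S\<inverse>) (T\<inverse>)"


section \<open>Diacritically compatible sets of functions\<close>

type_synonym rfun = "trel \<Rightarrow> trel"

text \<open>
  Unions of functions are pointwise, i.e. the library's \<open>sup\<close> and \<open>\<Squnion>\<close> on
  functions; in particular a set \<open>\<G>\<close> of functions is identified with \<open>Sup \<G>\<close>.
\<close>

definition hat :: "rfun \<Rightarrow> rfun" where
  "hat f = sup f id"

definition omega :: "rfun \<Rightarrow> rfun" where
  "omega f = (SUP n. f ^^ n)"

definition continuous_fun :: "rfun \<Rightarrow> bool" where
  "continuous_fun f \<longleftrightarrow> (\<forall>R. f R \<subseteq> \<Union> {f S | S. S \<subseteq> R \<and> finite S})"

definition evolves :: "rfun \<Rightarrow> rfun \<Rightarrow> rfun \<Rightarrow> bool" where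
  "evolves f g h \<longleftrightarrow> (\<forall>R T. progress R R T \<longrightarrow> progress (f R) (g R) (h T))"

definition strongly_evolves :: "rfun \<Rightarrow> rfun \<Rightarrow> rfun \<Rightarrow> bool" where
  "strongly_evolves f g h \<longleftrightarrow> (\<forall>R S T. progress R S T \<longrightarrow> progress (f R) (g S) (h T))"

definition strong_subset :: "rfun set \<Rightarrow> rfun set \<Rightarrow> bool" where
  "strong_subset \<S> \<F> \<longleftrightarrow> \<S> \<subseteq> \<F> \<and>
     (\<forall>f\<in>\<S>. strongly_evolves f (omega (hat (Sup \<S>))) (omega (hat (Sup \<F>)))) \<and>
     (\<forall>f\<in>\<F>. evolves f (omega (hat (Sup \<S>)) \<circ> hat (Sup \<F>) \<circ> omega (hat (Sup \<S>)))
        (omega (hat (Sup \<F>))))"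

definition diacritically_compatible :: "rfun set \<Rightarrow> bool" where
  "diacritically_compatible \<F> \<longleftrightarrow>
     (\<forall>f\<in>\<F>. continuous_fun f) \<and> (\<exists>\<S>. strong_subset \<S> \<F>)"

definition strong :: "rfun set \<Rightarrow> rfun set" where
  "strong \<F> = \<Union> {\<S>. strong_subset \<S> \<F>}"


section \<open>Up-to techniques\<close>

definition upto_refl :: rfun where
  "upto_refl R = {(t, t) | t. True}"

definition upto_lam :: rfun where
  "upto_lam R = {(Val (LAM x t), Val (LAM x s)) | x t s. (t, s) \<in> R}"

definition upto_subst :: rfun where
  "upto_subst R = {(t[x::=v], s[x::=w]) | t s x v w. (t, s) \<in> R \<and> (v, w) \<in> val_ext R}"

definition upto_red :: rfun where
  "upto_red R = {(t, s). \<exists>t' s'. t \<leadsto>* t' \<and> s \<leadsto>* s' \<and> (t', s') \<in> R}"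

definition upto_pctx :: rfun where
  "upto_pctx R = {(plug E t, plug E' s) | E E' t s. (t, s) \<in> R \<and>
     pure_ctx E \<and> pure_ctx E' \<and> (E, E') \<in> ctx_ext R}"

definition upto_pctxrst :: rfun where
  "upto_pctxrst R = {(Reset (plug E t), Reset (plug E' s)) | E E' t s. (t, s) \<in> R \<and>
     pure_ctx E \<and> pure_ctx E' \<and> (CReset E, CReset E') \<in> ctx_ext R}"

definition upto_ectxpure :: rfun where
  "upto_ectxpure R = {(plug F t, plug F' s) | F F' t s. (t, s) \<in> R \<and>
     pure_trm t \<and> pure_trm s \<and>
     (\<exists>x. x \<notin> fvc F \<union> fvc F' \<and> (plug F (tvar x), plug F' (tvar x)) \<in> R)}"

end

theory Submission
  imports Defs
begin

text \<open>
  Progress of a pair amounts to a case distinction on the left term: it reduces, is a value, is stuck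
  on a variable, or is stuck on a shift.  Writing \<open>U\<close> for the closure of \<open>T\<close> under all techniques
  and \<open>V\<close> for the closure of \<open>S\<close> under the strong ones, the core case is \<open>F[v a]\<close> against
  \<open>F'[w b]\<close> with \<open>v\<close>, \<open>w\<close> related by \<open>R\<close>: the test \<open>(v x, w x) \<in> R\<close> is answered by progress of
  \<open>R\<close>, and substituting \<open>a\<close>, \<open>b\<close> for \<open>x\<close> in the answer and plugging it into \<open>F\<close>, \<open>F'\<close> stays in \<open>U\<close>.
  This handles substitution; plugging a value into a context is an instance of substitution, and
  plugging any other term composes contexts.  The context techniques are not strong because a value
  may be answered by one that is related in \<open>S\<close> but not in \<open>R\<close>.
\<close>

section \<open>Substitution in terms and contexts\<close>

lemma psubst_psubst: "psubst \<sigma> (psubst \<tau> t) = psubst (\<lambda>i. psubstv \<sigma> (\<tau> i)) t"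
  and psubstv_psubstv: "psubstv \<sigma> (psubstv \<tau> v) = psubstv (\<lambda>i. psubstv \<sigma> (\<tau> i)) v"
proof (induct t and v arbitrary: \<sigma> \<tau> and \<sigma> \<tau> rule: trm.induct val.induct)
  case (Lam t)
  have "(\<lambda>i. psubstv (case_nat (Var 0) (\<lambda>i. renamev Suc (\<sigma> i)))
          (case_nat (Var 0) (\<lambda>i. renamev Suc (\<tau> i)) i))
      = case_nat (Var 0) (\<lambda>i. renamev Suc (psubstv \<sigma> (\<tau> i)))"
    by (simp add: fun_eq_iff psubstv_renamev renamev_psubstv split: nat.split)
  then show ?case by (simp add: Lam)
qed simp_all

lemma subst1v_fresh: "x \<notin> fvv w \<Longrightarrow> subst1v w x v = w"
  using psubstv_cong[of w "Var(x := v)" Var] by (metis fun_upd_other psubstv_Var)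

text \<open>No binder lies above the hole of an evaluation context, so substitution acts
  componentwise without lifting and commutes with plugging.\<close>

primrec psubstc :: "(nat \<Rightarrow> val) \<Rightarrow> ctx \<Rightarrow> ctx" where
  "psubstc \<sigma> Hole = Hole"
| "psubstc \<sigma> (CAppR v F) = CAppR (psubstv \<sigma> v) (psubstc \<sigma> F)"
| "psubstc \<sigma> (CAppL F s) = CAppL (psubstc \<sigma> F) (psubst \<sigma> s)"
| "psubstc \<sigma> (CReset F) = CReset (psubstc \<sigma> F)"

lemma psubst_plug: "psubst \<sigma> (plug F t) = plug (psubstc \<sigma> F) (psubst \<sigma> t)"
  by (induct F) simp_all

lemma psubstc_psubstc: "psubstc \<sigma> (psubstc \<tau> F) = psubstc (\<lambda>i. psubstv \<sigma> (\<tau> i)) F"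
  by (induct F) (simp_all add: psubst_psubst psubstv_psubstv)

lemma psubstc_cong: "(\<And>i. i \<in> fvc F \<Longrightarrow> \<sigma> i = \<tau> i) \<Longrightarrow> psubstc \<sigma> F = psubstc \<tau> F"
proof (induct F)
  case (CAppR v F)
  then show ?case using psubstv_cong[of v \<sigma> \<tau>] by simp
next
  case (CAppL F s)
  then show ?case using psubst_cong[of s \<sigma> \<tau>] by simp
qed simp_all

lemma psubstc_Var: "psubstc Var F = F"
  by (induct F) (simp_all add: psubst_Var psubstv_Var)

lemma psubstc_fresh: "x \<notin> fvc F \<Longrightarrow> psubstc (Var(x := v)) F = F"
  using psubstc_cong[of F "Var(x := v)" Var] by (metis fun_upd_other psubstc_Var)

lemma pure_psubstc [simp]: "pure_ctx (psubstc \<sigma> F) = pure_ctx F"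
  by (induct F) simp_all

lemma psubstc_ccomp: "psubstc \<sigma> (ccomp F G) = ccomp (psubstc \<sigma> F) (psubstc \<sigma> G)"
  by (induct F) simp_all

lemma plug_ccomp [simp]: "plug (ccomp F G) t = plug F (plug G t)"
  by (induct F) simp_all

lemma ccomp_assoc: "ccomp (ccomp F G) H = ccomp F (ccomp G H)"
  by (induct F) simp_all

lemma pure_ccomp [simp]: "pure_ctx (ccomp F G) \<longleftrightarrow> pure_ctx F \<and> pure_ctx G"
  by (induct F) simp_all

lemma finite_fvc: "finite (fvc F)"
  by (induct F) (simp_all add: finite_fv finite_fvv)

lemma impure_ctx_decomp:
  assumes "\<not> pure_ctx F"
  obtains G E where "pure_ctx E" "F = ccomp G (CReset E)"
proof -
  have "\<exists>G E. pure_ctx E \<and> F = ccomp G (CReset E)"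
    using assms
  proof (induct F)
    case (CAppR v F)
    then obtain G E where "pure_ctx E" "F = ccomp G (CReset E)" by auto
    then show ?case by (intro exI[of _ "CAppR v G"] exI[of _ E]) simp
  next
    case (CAppL F s)
    then obtain G E where "pure_ctx E" "F = ccomp G (CReset E)" by auto
    then show ?case by (intro exI[of _ "CAppL G s"] exI[of _ E]) simp
  next
    case (CReset F)
    show ?case
    proof (cases "pure_ctx F")
      case True
      then show ?thesis by (intro exI[of _ Hole] exI[of _ F]) simp
    next
      case False
      with CReset obtain G E where "pure_ctx E" "F = ccomp G (CReset E)" by auto
      then show ?thesis by (intro exI[of _ "CReset G"] exI[of _ E]) simp
    qed
  qed simp
  with that show ?thesis by blast
qed

text \<open>Purity of the inner part makes the displayed reset the innermost one above the hole, and
  there is only one such place.\<close>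

lemma ccomp_CReset_inj:
  "\<lbrakk>pure_ctx E; pure_ctx E'; ccomp F (CReset E) = ccomp F' (CReset E')\<rbrakk> \<Longrightarrow> F = F' \<and> E = E'"
proof (induct F arbitrary: F')
  case Hole
  then show ?case by (cases F') auto
next
  case (CAppR v F)
  then show ?case by (cases F') auto
next
  case (CAppL F s)
  then show ?case by (cases F') auto
next
  case (CReset F)
  then show ?case by (cases F') auto
qed


section \<open>Unique decomposition and determinism of reduction\<close>

text \<open>The reducible applications, the stuck ones, and the control redexes share the shape
  \<open>v w\<close>, so that one unique decomposition result covers reduction and stuck terms alike.\<close>

definition proto_redex :: "trm \<Rightarrow> bool" where
  "proto_redex r \<longleftrightarrow> (\<exists>v w. r = App (Val v) (Val w)) \<or> (\<exists>v. r = Reset (Val v))"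

lemma proto_redex_simps [simp]:
  "proto_redex (App (Val v) (Val w))" "proto_redex (Reset (Val v))" "\<not> proto_redex (Val v)"
  by (simp_all add: proto_redex_def)

lemma plug_eq_Val [simp]: "plug F t = Val v \<longleftrightarrow> F = Hole \<and> t = Val v"
  by (cases F) auto

lemma Val_eq_plug [simp]: "Val v = plug F t \<longleftrightarrow> F = Hole \<and> t = Val v"
  by (cases F) auto

text \<open>A context enters an argument only when the function part is a value, and a term with a
  proto-redex in evaluation position is never a value. So at each node of the term only one frame
  fits.\<close>

lemma plug_proto_inj:
  "\<lbrakk>proto_redex r; proto_redex r'; plug F r = plug F' r'\<rbrakk> \<Longrightarrow> F = F' \<and> r = r'"
proof (induct F arbitrary: F')
  case Hole
  then show ?case by (cases F') (auto simp: proto_redex_def)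
next
  case (CAppR v F)
  then show ?case by (cases F') (auto simp: proto_redex_def)
next
  case (CAppL F s)
  then show ?case by (cases F') (auto simp: proto_redex_def)
next
  case (CReset F)
  then show ?case by (cases F') (auto simp: proto_redex_def)
qed

lemma plug_proto_eq_iff:
  "\<lbrakk>proto_redex r; proto_redex r'\<rbrakk> \<Longrightarrow> plug F r = plug F' r' \<longleftrightarrow> F = F' \<and> r = r'"
  using plug_proto_inj by blast

lemma plug_proto_ex:
  obtains v where "t = Val v" | F r where "proto_redex r" "t = plug F r"
proof -
  have "(\<exists>v. t = Val v) \<or> (\<exists>F r. proto_redex r \<and> t = plug F r)"
  proof (induct t rule: trm.induct[where ?P2.0 = "\<lambda>_. True"])
    case (App t s)
    from App(1) show ?case
    proof (elim disjE exE conjE)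
      fix v assume t: "t = Val v"
      from App(2) show ?case
      proof (elim disjE exE conjE)
        fix w assume "s = Val w"
        with t show ?case by (intro disjI2 exI[of _ Hole] exI[of _ "App t s"]) simp
      next
        fix F r assume "proto_redex r" "s = plug F r"
        with t show ?case by (intro disjI2 exI[of _ "CAppR v F"] exI[of _ r]) simp
      qed
    next
      fix F r assume "proto_redex r" "t = plug F r"
      then show ?case by (intro disjI2 exI[of _ "CAppL F s"] exI[of _ r]) simp
    qed
  next
    case (Reset t)
    then show ?case
    proof (elim disjE exE conjE)
      fix v assume "t = Val v"
      then show ?case by (intro disjI2 exI[of _ Hole] exI[of _ "Reset t"]) simp
    next
      fix F r assume "proto_redex r" "t = plug F r"
      then show ?case by (intro disjI2 exI[of _ "CReset F"] exI[of _ r]) simp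
    qed
  qed simp_all
  with that show ?thesis by blast
qed

section \<open>Reduction steps without bound names\<close>

definition inst :: "trm \<Rightarrow> val \<Rightarrow> trm" where
  "inst b v = psubst (case_nat v Var) b"

text \<open>The delimited continuation captured by a shift redex. Raising the indices of
  \<open>E\<close> reserves 0 for the argument, so no fresh name has to be chosen.\<close>

definition kont :: "ctx \<Rightarrow> val" where
  "kont E = Lam (Reset (plug (psubstc (\<lambda>i. Var (Suc i)) E) (tvar 0)))"

text \<open>Abstraction sends the name \<open>x\<close> to index 0 and raises all others;
  \<open>inst\<close> puts \<open>v\<close> at 0 and lowers the rest again, which is the named beta
  contraction.\<close>

lemma inst_LAM_body: "inst (rename (\<lambda>y. if y = x then 0 else Suc y) t) v = t[x::=v]"
  unfolding inst_def psubst_rename by (rule psubst_cong) simp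

lemma LAM_kont:
  assumes "x \<notin> fvc E"
  shows "LAM x (Reset (plug E (tvar x))) = kont E"
proof -
  have "psubstc (\<lambda>i. Var (if i = x then 0 else Suc i)) E = psubstc (\<lambda>i. Var (Suc i)) E"
    using assms by (intro psubstc_cong) auto
  then show ?thesis
    by (simp add: LAM_def kont_def rename_eq_psubst psubst_plug)
qed

lemma psubst_inst:
  "psubst \<sigma> (inst b v) = inst (psubst (case_nat (Var 0) (\<lambda>i. renamev Suc (\<sigma> i))) b) (psubstv \<sigma> v)"
  unfolding inst_def psubst_psubst
  by (rule psubst_cong) (simp add: psubstv_renamev psubstv_Var split: nat.split)

lemma psubstv_kont: "psubstv \<sigma> (kont E) = kont (psubstc \<sigma> E)"
proof -
  have "(\<lambda>i. psubstv (case_nat (Var 0) (\<lambda>i. renamev Suc (\<sigma> i))) (Var (Suc i)))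
      = (\<lambda>i. psubstv (\<lambda>i. Var (Suc i)) (\<sigma> i))"
    using renamev_psubstv[of Suc Var] by (simp add: psubstv_Var)
  then show ?thesis
    by (simp only: kont_def psubstv.simps psubst.simps psubst_plug psubstc_psubstc nat.case)
qed

lemma inst_kont_body:
  "inst (Reset (plug (psubstc (\<lambda>i. Var (Suc i)) E) (tvar 0))) v = Reset (plug E (Val v))"
  by (simp add: inst_def psubst_plug psubstc_psubstc psubstc_Var)

lemma step_beta: "plug F (App (Val (Lam b)) (Val v)) \<leadsto> plug F (inst b v)"
proof -
  obtain x where x: "x \<notin> fvv (Lam b)"
    using ex_new_if_finite[OF infinite_UNIV_nat finite_fvv] by blast
  have "(psubst (case_nat (Var x) Var) b)[x::=v] = inst b v"
    unfolding inst_def psubst_psubst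
    by (rule psubst_cong) (use x in \<open>auto split: nat.split\<close>)
  then show ?thesis
    using step.beta[of F x "psubst (case_nat (Var x) Var) b" v] Lam_eq_LAM[OF x] by simp
qed

lemma step_shift:
  assumes "pure_ctx E"
  shows "plug F (Reset (plug E (App (Val Shift) (Val v))))
    \<leadsto> plug F (Reset (App (Val v) (Val (kont E))))"
proof -
  obtain x where "x \<notin> fvc E"
    using ex_new_if_finite[OF infinite_UNIV_nat finite_fvc] by blast
  with step.shift[OF assms this] show ?thesis by (simp add: LAM_kont)
qed

text \<open>In the shift case the left side is a single composed context around
  \<open>App (Val Shift) (Val v)\<close>, the shape to which unique decomposition applies. Uses of
  this rule keep \<open>plug_ccomp\<close> out of simplification to preserve that shape.\<close>

lemma stepE [consumes 1, case_names beta shift reset]: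
  assumes "t \<leadsto> t'"
  obtains F b v where "t = plug F (App (Val (Lam b)) (Val v))" "t' = plug F (inst b v)"
  | F E v where "pure_ctx E" "t = plug (ccomp F (CReset E)) (App (Val Shift) (Val v))"
      "t' = plug F (Reset (App (Val v) (Val (kont E))))"
  | F v where "t = plug F (Reset (Val v))" "t' = plug F (Val v)"
  using assms
proof (cases rule: step.cases)
  case (beta F x t v)
  then show ?thesis using that(1) by (metis LAM_def inst_LAM_body)
next
  case (shift E x F v)
  then show ?thesis using that(2)[of E F v] by (simp add: LAM_kont)
next
  case (reset F v)
  then show ?thesis using that(3) by blast
qed

lemma step_deterministic:
  assumes "t \<leadsto> t1" "t \<leadsto> t2"
  shows "t1 = t2"
  using assms(1)
proof (cases rule: stepE)
  case 1: (beta F b v)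
  from assms(2) show ?thesis
    by (cases rule: stepE) (use 1 in \<open>simp_all add: plug_proto_eq_iff del: plug_ccomp\<close>)
next
  case 1: (shift F E v)
  from assms(2) show ?thesis
    by (cases rule: stepE)
      (use 1 in \<open>auto simp: plug_proto_eq_iff dest: ccomp_CReset_inj simp del: plug_ccomp\<close>)
next
  case 1: (reset F v)
  from assms(2) show ?thesis
    by (cases rule: stepE) (use 1 in \<open>simp_all add: plug_proto_eq_iff del: plug_ccomp\<close>)
qed

lemma Val_irreducible: "\<not> Val v \<leadsto> t"
  by (auto elim!: stepE)

lemma open_irreducible: "\<not> plug F (App (tvar x) (Val v)) \<leadsto> t"
  by (auto elim!: stepE simp: plug_proto_eq_iff simp del: plug_ccomp)

lemma ctrl_irreducible: "pure_ctx E \<Longrightarrow> \<not> plug E (App (Val Shift) (Val v)) \<leadsto> t"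
  by (auto elim!: stepE simp: plug_proto_eq_iff simp del: plug_ccomp)

text \<open>The function value of the proto-redex decides the case, except for \<open>Shift\<close>:
  with a reset in the context it gives a redex, in a pure context a stuck term.\<close>

lemma trm_cases [case_names red val opn ctrl]:
  obtains t' where "t \<leadsto> t'" | v where "t = Val v"
  | F x v where "t = plug F (App (tvar x) (Val v))"
  | E v where "pure_ctx E" "t = plug E (App (Val Shift) (Val v))"
proof (cases t rule: plug_proto_ex)
  case (1 v)
  with that show ?thesis by blast
next
  case (2 F r)
  then consider v w where "r = App (Val v) (Val w)" | v where "r = Reset (Val v)"
    by (auto simp: proto_redex_def)
  then show ?thesis
  proof cases
    case r: (1 v w)
    show ?thesis
    proof (cases v)
      case (Var x)
      with r 2 that show ?thesis by blast
    next
      case (Lam b)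
      with r 2 that step_beta show ?thesis by blast
    next
      case Shift
      show ?thesis
      proof (cases "pure_ctx F")
        case True
        with Shift r 2 that show ?thesis by blast
      next
        case False
        then obtain G E where "pure_ctx E" "F = ccomp G (CReset E)" by (rule impure_ctx_decomp)
        with Shift r 2 that step_shift[of E G w] show ?thesis by auto
      qed
    qed
  next
    case (2 v)
    with \<open>t = plug F r\<close> that step.reset show ?thesis by blast
  qed
qed

lemma step_plug: "t \<leadsto> t' \<Longrightarrow> plug G t \<leadsto> plug G t'"
proof (induct rule: step.induct)
  case (beta F x t v)
  show ?case using step.beta[of "ccomp G F"] by simp
next
  case (shift E x F v)
  then show ?case using step.shift[of E x "ccomp G F"] by simp
next
  case (reset F v)
  show ?case using step.reset[of "ccomp G F"] by simp
qed

lemma steps_plug: "t \<leadsto>* t' \<Longrightarrow> plug G t \<leadsto>* plug G t'"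
  by (induct rule: rtranclp_induct) (auto intro: step_plug rtranclp.rtrancl_into_rtrancl)

lemma step_psubst:
  assumes "t \<leadsto> t'"
  shows "psubst \<sigma> t \<leadsto> psubst \<sigma> t'"
  using assms
proof (cases rule: stepE)
  case (beta F b v)
  then show ?thesis by (simp add: psubst_plug psubst_inst step_beta)
next
  case (shift F E v)
  then show ?thesis
    using step_shift[of "psubstc \<sigma> E" "psubstc \<sigma> F" "psubstv \<sigma> v"]
    by (simp add: psubst_plug psubstv_kont)
next
  case (reset F v)
  then show ?thesis by (simp add: psubst_plug step.reset)
qed

lemma steps_psubst: "t \<leadsto>* t' \<Longrightarrow> psubst \<sigma> t \<leadsto>* psubst \<sigma> t'"
  by (induct rule: rtranclp_induct) (auto intro: step_psubst rtranclp.rtrancl_into_rtrancl)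


section \<open>Progress of a pair of terms\<close>

lemma finite_fresh:
  assumes "finite A"
  obtains x :: nat where "x \<notin> A"
  using ex_new_if_finite[OF infinite_UNIV_nat assms] by blast

text \<open>One fresh-variable test serving three purposes: contexts, values through
  \<open>CAppR v Hole\<close>, and the argument of shift through
  \<open>CReset (CAppR v Hole)\<close>. Facts about contexts thereby cover all three.\<close>

definition ctx_rel :: "trel \<Rightarrow> ctx \<Rightarrow> ctx \<Rightarrow> bool" where
  "ctx_rel R F F' \<longleftrightarrow>
    (\<exists>x. x \<notin> fvc F \<union> fvc F' \<and> (plug F (tvar x), plug F' (tvar x)) \<in> R)"

lemma val_ext_iff: "(v, w) \<in> val_ext R \<longleftrightarrow> ctx_rel R (CAppR v Hole) (CAppR w Hole)"
  by (simp add: val_ext_def ctx_rel_def)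

lemma ctx_rel_mono: "ctx_rel R F F' \<Longrightarrow> R \<subseteq> S \<Longrightarrow> ctx_rel S F F'"
  by (auto simp: ctx_rel_def)

lemma val_ext_mono: "R \<subseteq> S \<Longrightarrow> val_ext R \<subseteq> val_ext S"
  by (auto simp: val_ext_iff intro: ctx_rel_mono)

lemma ctx_ext_mono: "R \<subseteq> S \<Longrightarrow> ctx_ext R \<subseteq> ctx_ext S"
  by (auto elim!: ctx_ext.cases intro: ctx_ext.intros)

lemma ctx_ext_cases [consumes 1, case_names pure impure]:
  assumes "(F, F') \<in> ctx_ext R"
  obtains "pure_ctx F" "pure_ctx F'" "ctx_rel R F F'"
  | G E G' E' where "F = ccomp G (CReset E)" "F' = ccomp G' (CReset E')" "pure_ctx E" "pure_ctx E'"
      "ctx_rel R G G'" "ctx_rel R (CReset E) (CReset E')"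
  using assms
proof (cases rule: ctx_ext.cases)
  case (pure x)
  with that(1) show ?thesis by (auto simp: ctx_rel_def)
next
  case (impure E E' x F F')
  with that(2)[of F E F' E'] show ?thesis by (auto simp: ctx_rel_def)
qed

lemma ctx_ext_pure:
  "pure_ctx E \<Longrightarrow> pure_ctx E' \<Longrightarrow> ctx_rel R E E' \<Longrightarrow> (E, E') \<in> ctx_ext R"
  by (auto simp: ctx_rel_def intro: ctx_ext.intros)

text \<open>\<open>CReset E\<close> with \<open>E\<close> pure splits only with an empty outer part,
  so its inner test is the test of the whole context.\<close>

lemma ctx_ext_CReset:
  assumes "(CReset E, CReset E') \<in> ctx_ext R" "pure_ctx E" "pure_ctx E'"
  shows "ctx_rel R (CReset E) (CReset E')"
  using assms(1)
proof (cases rule: ctx_ext_cases)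
  case (impure G D G' D')
  with ccomp_CReset_inj[of E D Hole G] ccomp_CReset_inj[of E' D' Hole G'] assms
  show ?thesis by simp
qed simp

lemma evaluatesI: "s \<leadsto>* s' \<Longrightarrow> (\<And>t. \<not> s' \<leadsto> t) \<Longrightarrow> s \<Down> s'"
  by (auto simp: evaluates_def)

lemma evaluates_steps: "s \<Down> s' \<Longrightarrow> s \<leadsto>* s'"
  by (simp add: evaluates_def)

text \<open>Progress of a single pair in one direction, organised by the shape of the left term.
  Plain reduction replaces evaluation because the normal forms in the rules are irreducible by
  shape.\<close>

inductive sim :: "trel \<Rightarrow> trel \<Rightarrow> trm \<Rightarrow> trm \<Rightarrow> bool" for S T where
  red: "\<lbrakk>t \<leadsto> t'; s \<leadsto>* s'; (t', s') \<in> T\<rbrakk> \<Longrightarrow> sim S T t s"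
| val: "\<lbrakk>s \<leadsto>* Val w; (v, w) \<in> val_ext S\<rbrakk> \<Longrightarrow> sim S T (Val v) s"
| opn: "\<lbrakk>s \<leadsto>* plug F' (App (tvar x) (Val w)); (F, F') \<in> ctx_ext T; (v, w) \<in> val_ext T\<rbrakk>
    \<Longrightarrow> sim S T (plug F (App (tvar x) (Val v))) s"
| ctrl: "\<lbrakk>s \<leadsto>* plug E' (App (Val Shift) (Val w)); pure_ctx E; pure_ctx E'; (E, E') \<in> ctx_ext T;
      ctx_rel T (CReset (CAppR v Hole)) (CReset (CAppR w Hole))\<rbrakk>
    \<Longrightarrow> sim S T (plug E (App (Val Shift) (Val v))) s"

lemma sim_mono:
  assumes "sim S T t s" "S \<subseteq> S'" "T \<subseteq> T'"
  shows "sim S' T' t s"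
  using assms(1)
  by cases (use assms(2,3) val_ext_mono[OF assms(2)] val_ext_mono[OF assms(3)] ctx_ext_mono[OF assms(3)]
      ctx_rel_mono[OF _ assms(3)] in \<open>blast intro: sim.intros\<close>)+

text \<open>Every rule constrains the right term only through its reducts, which an expansion also
  reaches.\<close>

lemma sim_backward: "sim S T t s \<Longrightarrow> s' \<leadsto>* s \<Longrightarrow> sim S T t s'"
  by (erule sim.cases) (auto intro: sim.intros rtranclp_trans)

text \<open>One direction is the case split \<open>trm_cases\<close>. The other rests on the four
  shapes excluding each other and on reduction and decomposition being unique, so that a single rule
  of \<open>sim\<close> answers all clauses.\<close>

lemma half_progress_iff: "half_progress R S T \<longleftrightarrow> (\<forall>t s. (t, s) \<in> R \<longrightarrow> sim S T t s)"
proof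
  assume H: "half_progress R S T"
  show "\<forall>t s. (t, s) \<in> R \<longrightarrow> sim S T t s"
  proof (intro allI impI)
    fix t s assume "(t, s) \<in> R"
    note H = H[unfolded half_progress_def, rule_format, OF this]
    show "sim S T t s"
    proof (cases t rule: trm_cases)
      case (red t')
      with H show ?thesis by (blast intro: sim.red)
    next
      case (val v)
      with H show ?thesis by (blast intro: sim.val dest: evaluates_steps)
    next
      case (opn F x v)
      with H obtain F' w where s: "s \<Down> plug F' (App (tvar x) (Val w))"
        and "(t, plug F' (App (tvar x) (Val w))) \<in> open_ext T"
        by blast
      \<comment> \<open>\<open>open_ext\<close> hides its contexts and values behind existentials;
        unique decomposition identifies them with the given ones.\<close>
      then have "(F, F') \<in> ctx_ext T" "(v, w) \<in> val_ext T"
        by (auto simp: opn open_ext_def plug_proto_eq_iff)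
      then show ?thesis unfolding opn using evaluates_steps[OF s] by (intro sim.opn)
    next
      case (ctrl E v)
      with H obtain E' w where s: "pure_ctx E'" "s \<Down> plug E' (App (Val Shift) (Val w))"
        and "(t, plug E' (App (Val Shift) (Val w))) \<in> ctrl_ext T"
        by blast
      then have "(E, E') \<in> ctx_ext T" "ctx_rel T (CReset (CAppR v Hole)) (CReset (CAppR w Hole))"
        by (auto simp: ctrl ctrl_ext_def plug_proto_eq_iff ctx_rel_def)
      then show ?thesis unfolding ctrl using evaluates_steps[OF s(2)] s(1) ctrl(1) by (intro sim.ctrl)
    qed
  qed
next
  assume H: "\<forall>t s. (t, s) \<in> R \<longrightarrow> sim S T t s"
  show "half_progress R S T"
    unfolding half_progress_def
  proof (intro allI impI)
    fix t s assume "(t, s) \<in> R"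
    with H have "sim S T t s" by blast
    then show "(\<forall>t'. t \<leadsto> t' \<longrightarrow> (\<exists>s'. s \<leadsto>* s' \<and> (t', s') \<in> T)) \<and>
     (\<forall>v. t = Val v \<longrightarrow> (\<exists>w. s \<Down> Val w \<and> (v, w) \<in> val_ext S)) \<and>
     (\<forall>F x v. t = plug F (App (tvar x) (Val v)) \<longrightarrow>
        (\<exists>F' w. s \<Down> plug F' (App (tvar x) (Val w)) \<and>
           (t, plug F' (App (tvar x) (Val w))) \<in> open_ext T)) \<and>
     (\<forall>E v. pure_ctx E \<and> t = plug E (App (Val Shift) (Val v)) \<longrightarrow>
        (\<exists>E' w. pure_ctx E' \<and> s \<Down> plug E' (App (Val Shift) (Val w)) \<and>
           (t, plug E' (App (Val Shift) (Val w))) \<in> ctrl_ext T))"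
    proof cases
      case (red t' s')
      then show ?thesis
        using step_deterministic Val_irreducible open_irreducible ctrl_irreducible by blast
    next
      case (val w v)
      then have "s \<Down> Val w" by (intro evaluatesI) (simp_all add: Val_irreducible)
      with val show ?thesis by (auto simp: Val_irreducible)
    next
      case (opn F' x w F v)
      then have "s \<Down> plug F' (App (tvar x) (Val w))"
        by (intro evaluatesI) (simp_all add: open_irreducible)
      moreover have "(t, plug F' (App (tvar x) (Val w))) \<in> open_ext T"
        using opn unfolding open_ext_def by blast
      ultimately show ?thesis
        using opn(1) open_irreducible by (auto simp: plug_proto_eq_iff)
    next
      case (ctrl E' w E v)
      then have "s \<Down> plug E' (App (Val Shift) (Val w))"
        by (intro evaluatesI) (simp_all add: ctrl_irreducible)
      moreover have "(t, plug E' (App (Val Shift) (Val w))) \<in> ctrl_ext T"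
        using ctrl by (fastforce simp: ctrl_ext_def ctx_rel_def)
      ultimately show ?thesis
        using ctrl ctrl_irreducible by (auto simp: plug_proto_eq_iff)
    qed
  qed
qed


section \<open>Relations closed under the up-to techniques\<close>

text \<open>Abstracts what is used of the iterated closures: later instances are the strong closure
  of \<open>S\<close> and the full closure of \<open>T\<close>, as well as their converses.\<close>

locale strong_closed =
  fixes U :: trel
  assumes refl_closed: "upto_refl U \<subseteq> U"
    and subst_closed: "upto_subst U \<subseteq> U"
    and red_closed: "upto_red U \<subseteq> U"
begin

lemma reflI: "(t, t) \<in> U"
  using refl_closed by (auto simp: upto_refl_def)

lemma substI: "(t, s) \<in> U \<Longrightarrow> (v, w) \<in> val_ext U \<Longrightarrow> (t[x::=v], s[x::=w]) \<in> U"
  using subst_closed unfolding upto_subst_def by blast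

lemma redI: "(t', s') \<in> U \<Longrightarrow> t \<leadsto>* t' \<Longrightarrow> s \<leadsto>* s' \<Longrightarrow> (t, s) \<in> U"
  using red_closed by (auto simp: upto_red_def)

lemma ctx_rel_refl: "ctx_rel U F F"
  using finite_fresh[OF finite_fvc[of F]] reflI by (auto simp: ctx_rel_def)

lemma val_ext_refl: "(v, v) \<in> val_ext U"
  by (simp add: val_ext_iff ctx_rel_refl)

text \<open>The values are substituted for the test variable; its freshness leaves the contexts
  unchanged.\<close>

lemma ctx_rel_plug:
  assumes "ctx_rel U F F'" "(v, w) \<in> val_ext U"
  shows "(plug F (Val v), plug F' (Val w)) \<in> U"
proof -
  obtain x where "x \<notin> fvc F \<union> fvc F'" "(plug F (tvar x), plug F' (tvar x)) \<in> U"
    using assms(1) by (auto simp: ctx_rel_def)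
  with substI[OF _ assms(2), of "plug F (tvar x)" "plug F' (tvar x)" x] show ?thesis
    by (simp add: psubst_plug psubstc_fresh)
qed

text \<open>Substituting one variable for another moves the test to any variable. With
  \<open>ctx_relI\<close> the existential choice of the fresh variable thus becomes immaterial in
  \<open>U\<close>.\<close>

lemma ctx_relD: "ctx_rel U F F' \<Longrightarrow> (plug F (tvar y), plug F' (tvar y)) \<in> U"
  by (simp add: ctx_rel_plug val_ext_refl)

lemma ctx_relI: "(\<And>y. (plug F (tvar y), plug F' (tvar y)) \<in> U) \<Longrightarrow> ctx_rel U F F'"
  using finite_fresh[of "fvc F \<union> fvc F'"] by (auto simp: ctx_rel_def finite_fvc)

lemma ctx_rel_subst:
  assumes "ctx_rel U F F'" "(v, w) \<in> val_ext U"
  shows "ctx_rel U (psubstc (Var(z := v)) F) (psubstc (Var(z := w)) F')" (is "ctx_rel U ?G ?G'")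
proof -
  \<comment> \<open>Avoiding \<open>z\<close> keeps the test variable out of the substitution;
    avoiding \<open>?G\<close> and \<open>?G'\<close> keeps it fresh afterwards.\<close>
  obtain y where y: "y \<notin> insert z (fvc ?G \<union> fvc ?G')"
    using finite_fresh[of "insert z (fvc ?G \<union> fvc ?G')"] by (auto simp: finite_fvc)
  have "(plug ?G (tvar y), plug ?G' (tvar y)) \<in> U"
    using substI[OF ctx_relD[OF assms(1), of y] assms(2), of z] y by (simp add: psubst_plug)
  with y show ?thesis by (auto simp: ctx_rel_def)
qed

lemma val_ext_subst:
  assumes "(u, u') \<in> val_ext U" "(v, w) \<in> val_ext U"
  shows "(subst1v u z v, subst1v u' z w) \<in> val_ext U"
  using ctx_rel_subst[OF assms(1)[unfolded val_ext_iff] assms(2)] by (simp add: val_ext_iff)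

text \<open>The two given tests may rest on different variables, while \<open>ctx_ext.impure\<close>
  asks for a common one; \<open>ctx_relD\<close> moves both to it.\<close>

lemma ctx_ext_impure:
  assumes "ctx_rel U F F'" "ctx_rel U (CReset E) (CReset E')" "pure_ctx E" "pure_ctx E'"
  shows "(ccomp F (CReset E), ccomp F' (CReset E')) \<in> ctx_ext U"
proof -
  obtain x where "x \<notin> fvc F \<union> fvc E \<union> fvc F' \<union> fvc E'"
    using finite_fresh[of "fvc F \<union> fvc E \<union> fvc F' \<union> fvc E'"] by (auto simp: finite_fvc)
  with ctx_ext.impure[of E E' x F F' U] ctx_relD[OF assms(1), of x] ctx_relD[OF assms(2), of x] assms(3,4)
  show ?thesis by simp
qed

lemma ctx_ext_subst:
  assumes "(F, F') \<in> ctx_ext U" "(v, w) \<in> val_ext U"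
  shows "(psubstc (Var(z := v)) F, psubstc (Var(z := w)) F') \<in> ctx_ext U"
  using assms(1)
proof (cases rule: ctx_ext_cases)
  case pure
  then show ?thesis by (intro ctx_ext_pure) (simp_all add: ctx_rel_subst assms(2))
next
  case (impure G E G' E')
  then show ?thesis
    using ctx_rel_subst[OF impure(5) assms(2), of z] ctx_rel_subst[OF impure(6) assms(2), of z]
    by (simp add: psubstc_ccomp ctx_ext_impure)
qed

lemma ctx_ext_refl: "(F, F) \<in> ctx_ext U"
proof (cases "pure_ctx F")
  case True
  then show ?thesis by (simp add: ctx_ext_pure ctx_rel_refl)
next
  case False
  then show ?thesis by (rule impure_ctx_decomp) (simp add: ctx_ext_impure ctx_rel_refl)
qed

text \<open>Applied to a variable, a captured continuation reduces to its reset context around that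
  variable, so closure under reduction turns the context test into a value test.\<close>

lemma kont_val_ext:
  assumes "ctx_rel U (CReset E) (CReset E')"
  shows "(kont E, kont E') \<in> val_ext U"
proof -
  have "App (Val (kont D)) (tvar y) \<leadsto>* Reset (plug D (tvar y))" for D y
    using step_beta[of Hole "Reset (plug (psubstc (\<lambda>i. Var (Suc i)) D) (tvar 0))" "Var y"]
    unfolding inst_kont_body by (simp add: kont_def)
  then show ?thesis
    unfolding val_ext_iff using ctx_relD[OF assms]
    by (intro ctx_relI) (simp, blast intro: redI)
qed

text \<open>The bound name itself is the test variable: it is not free in the abstraction, and
  applying the abstraction to it gives back the body.\<close>

lemma LAM_val_ext:
  assumes "(t, s) \<in> U"
  shows "(LAM x t, LAM x s) \<in> val_ext U"
proof -
  have "App (Val (LAM x r)) (tvar x) \<leadsto>* r" for r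
    using step.beta[of Hole x r "Var x"] by (simp add: psubst_Var)
  with assms have "(App (Val (LAM x t)) (tvar x), App (Val (LAM x s)) (tvar x)) \<in> U"
    by (blast intro: redI)
  moreover have "x \<notin> fvv (LAM x t) \<union> fvv (LAM x s)"
    by (simp add: fvv_LAM)
  ultimately show ?thesis unfolding val_ext_def by blast
qed

end

locale full_closed = strong_closed +
  assumes pctx_closed: "upto_pctx U \<subseteq> U"
    and pctxrst_closed: "upto_pctxrst U \<subseteq> U"
    and ectxpure_closed: "upto_ectxpure U \<subseteq> U"
begin

lemma pctxI:
  "\<lbrakk>(t, s) \<in> U; pure_ctx E; pure_ctx E'; ctx_rel U E E'\<rbrakk> \<Longrightarrow> (plug E t, plug E' s) \<in> U"
  using pctx_closed ctx_ext_pure unfolding upto_pctx_def by blast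

lemma pctxrstI:
  assumes "(t, s) \<in> U" "pure_ctx E" "pure_ctx E'" "ctx_rel U (CReset E) (CReset E')"
  shows "(Reset (plug E t), Reset (plug E' s)) \<in> U"
proof -
  have "(CReset E, CReset E') \<in> ctx_ext U"
    using ctx_ext_impure[OF ctx_rel_refl[of Hole] assms(4,2,3)] by simp
  with assms show ?thesis using pctxrst_closed unfolding upto_pctxrst_def by blast
qed

lemma ectxpureI:
  "\<lbrakk>(t, s) \<in> U; pure_trm t; pure_trm s; ctx_rel U F F'\<rbrakk> \<Longrightarrow> (plug F t, plug F' s) \<in> U"
  using ectxpure_closed unfolding upto_ectxpure_def ctx_rel_def by blast

text \<open>In the impure case \<open>pctxrst\<close> fills the inner part up to its reset. The
  result is a pure term, so \<open>ectxpure\<close> can place it in the outer part.\<close>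

lemma ctx_extI:
  assumes "(F, F') \<in> ctx_ext U" "(t, s) \<in> U"
  shows "(plug F t, plug F' s) \<in> U"
  using assms(1)
proof (cases rule: ctx_ext_cases)
  case pure
  with assms(2) show ?thesis by (simp add: pctxI)
next
  case (impure G E G' E')
  then have "(Reset (plug E t), Reset (plug E' s)) \<in> U"
    using assms(2) by (intro pctxrstI)
  then have "(plug G (Reset (plug E t)), plug G' (Reset (plug E' s))) \<in> U"
    using impure(5) by (intro ectxpureI) (auto simp: pure_trm_def)
  with impure show ?thesis by simp
qed

text \<open>The innermost reset of the composite is that of \<open>G\<close> if there is one, and
  then \<open>F\<close> joins the outer part; otherwise it is that of \<open>F\<close>, if any, and
  \<open>G\<close> joins the inner part.\<close>

lemma ctx_ext_ccomp:
  assumes F: "(F, F') \<in> ctx_ext U" and G: "(G, G') \<in> ctx_ext U"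
  shows "(ccomp F G, ccomp F' G') \<in> ctx_ext U"
  using G
proof (cases rule: ctx_ext_cases)
  case G: pure
  from F show ?thesis
  proof (cases rule: ctx_ext_cases)
    case pure
    with G show ?thesis
      by (intro ctx_ext_pure ctx_relI) (simp_all add: pctxI ctx_relD)
  next
    case (impure H E H' E')
    have "ctx_rel U (CReset (ccomp E G)) (CReset (ccomp E' G'))"
      using impure G by (intro ctx_relI) (simp add: pctxrstI ctx_relD)
    with impure G show ?thesis by (simp add: ccomp_assoc ctx_ext_impure)
  qed
next
  case (impure H E H' E')
  have "ctx_rel U (ccomp F H) (ccomp F' H')"
    using impure by (intro ctx_relI) (simp add: ctx_extI[OF F] ctx_relD)
  with impure show ?thesis using ctx_ext_impure[of "ccomp F H" "ccomp F' H'" E E']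
    by (simp add: ccomp_assoc)
qed

text \<open>Covers both a control-stuck term and, when the context contains a reset, a shift redex.\<close>

lemma sim_Shift:
  assumes "(F, F') \<in> ctx_ext U" "ctx_rel U (CReset (CAppR v Hole)) (CReset (CAppR w Hole))"
    and s: "s \<leadsto>* plug F' (App (Val Shift) (Val w))"
  shows "sim V U (plug F (App (Val Shift) (Val v))) s"
  using assms(1)
proof (cases rule: ctx_ext_cases)
  case pure
  with assms show ?thesis by (intro sim.ctrl)
next
  case (impure G E G' E')
  let ?t' = "plug G (Reset (App (Val v) (Val (kont E))))"
    and ?s' = "plug G' (Reset (App (Val w) (Val (kont E'))))"
  have t: "plug F (App (Val Shift) (Val v)) \<leadsto> ?t'"
    using step_shift[of E G v] impure by simp
  have "s \<leadsto>* ?s'"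
    using s step_shift[of E' G' w] impure by (simp add: rtranclp.rtrancl_into_rtrancl)
  \<comment> \<open>The test variable in the hypothesis on \<open>v\<close> and \<open>w\<close> is
    replaced by the two captured continuations.\<close>
  moreover have "(Reset (App (Val v) (Val (kont E))), Reset (App (Val w) (Val (kont E')))) \<in> U"
    using ctx_rel_plug[OF assms(2) kont_val_ext[OF impure(6)]] by simp
  then have "(?t', ?s') \<in> U"
    using impure(5) by (intro ectxpureI) (auto simp: pure_trm_def)
  ultimately show ?thesis using t by (intro sim.red)
qed

text \<open>The answer to the test \<open>v y\<close> against \<open>w y\<close> is instantiated at
  the actual arguments and placed into the contexts, which stays in \<open>U\<close>. As an
  application is not a value, \<open>V\<close> can be arbitrary.\<close>

lemma sim_App:
  assumes sim: "sim S T (App (Val v) (tvar y)) (App (Val w) (tvar y))" and "T \<subseteq> U"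
    and y: "y \<notin> fvv v \<union> fvv w"
    and F: "(F, F') \<in> ctx_ext U" and a: "(a, b) \<in> val_ext U"
  shows "sim V U (plug F (App (Val v) (Val a))) (plug F' (App (Val w) (Val b)))"
proof -
  let ?\<sigma> = "Var(y := a)" and ?\<tau> = "Var(y := b)"
  have v: "psubst ?\<sigma> (App (Val v) (tvar y)) = App (Val v) (Val a)"
    and w: "psubst ?\<tau> (App (Val w) (tvar y)) = App (Val w) (Val b)"
    using y by (simp_all add: subst1v_fresh)
  have steps: "plug F' (App (Val w) (Val b)) \<leadsto>* plug F' (psubst ?\<tau> r)"
    if "App (Val w) (tvar y) \<leadsto>* r" for r
    using steps_plug[OF steps_psubst[OF that, of ?\<tau>], of F'] w by simp
  from sim show ?thesis
  proof cases
    case (red t' s')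
    have "plug F (App (Val v) (Val a)) \<leadsto> plug F (psubst ?\<sigma> t')"
      using step_plug[OF step_psubst[OF red(1), of ?\<sigma>], of F] v by simp
    moreover have "(plug F (psubst ?\<sigma> t'), plug F' (psubst ?\<tau> s')) \<in> U"
      using red(3) \<open>T \<subseteq> U\<close> a by (intro ctx_extI[OF F] substI) auto
    ultimately show ?thesis using steps[OF red(2)] by (intro sim.red)
  next
    case (opn G' z u' G u)
    from opn(1) have "v = Var z" by (cases G) auto
    \<comment> \<open>The head variable is \<open>v\<close> itself, for which \<open>y\<close> is
      fresh; so substituting for \<open>y\<close> preserves the head.\<close>
    with y have z: "z \<noteq> y" by auto
    have G: "(psubstc ?\<sigma> G, psubstc ?\<tau> G') \<in> ctx_ext U"
      and u: "(psubstv ?\<sigma> u, psubstv ?\<tau> u') \<in> val_ext U"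
      using opn(3,4) ctx_ext_mono[OF \<open>T \<subseteq> U\<close>] val_ext_mono[OF \<open>T \<subseteq> U\<close>] a
      by (auto intro!: ctx_ext_subst val_ext_subst)
    have "plug F' (App (Val w) (Val b)) \<leadsto>*
        plug (ccomp F' (psubstc ?\<tau> G')) (App (tvar z) (Val (psubstv ?\<tau> u')))"
      using steps[OF opn(2)] z by (simp add: psubst_plug)
    from sim.opn[OF this ctx_ext_ccomp[OF F G] u]
    have "sim V U (plug (ccomp F (psubstc ?\<sigma> G)) (App (tvar z) (Val (psubstv ?\<sigma> u))))
        (plug F' (App (Val w) (Val b)))" .
    moreover have "App (Val v) (Val a) = plug (psubstc ?\<sigma> G) (App (tvar z) (Val (psubstv ?\<sigma> u)))"
      using arg_cong[OF opn(1), of "psubst ?\<sigma>"] v z by (simp add: psubst_plug)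
    ultimately show ?thesis by simp
  next
    case (ctrl G' u' G u)
    have G: "(psubstc ?\<sigma> G, psubstc ?\<tau> G') \<in> ctx_ext U"
      using ctrl(5) ctx_ext_mono[OF \<open>T \<subseteq> U\<close>] a by (auto intro!: ctx_ext_subst)
    have u: "ctx_rel U (CReset (CAppR (psubstv ?\<sigma> u) Hole)) (CReset (CAppR (psubstv ?\<tau> u') Hole))"
      using ctx_rel_subst[OF ctx_rel_mono[OF ctrl(6) \<open>T \<subseteq> U\<close>] a] by simp
    have "plug F' (App (Val w) (Val b)) \<leadsto>*
        plug (ccomp F' (psubstc ?\<tau> G')) (App (Val Shift) (Val (psubstv ?\<tau> u')))"
      using steps[OF ctrl(2)] by (simp add: psubst_plug)
    from sim_Shift[OF ctx_ext_ccomp[OF F G] u this]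
    have "sim V U (plug (ccomp F (psubstc ?\<sigma> G)) (App (Val Shift) (Val (psubstv ?\<sigma> u))))
        (plug F' (App (Val w) (Val b)))" .
    moreover have "App (Val v) (Val a) = plug (psubstc ?\<sigma> G) (App (Val Shift) (Val (psubstv ?\<sigma> u)))"
      using arg_cong[OF ctrl(1), of "psubst ?\<sigma>"] v by (simp add: psubst_plug)
    ultimately show ?thesis by simp
  qed
qed

text \<open>Answers are stable under substitution unless the term is stuck on \<open>x\<close>
  itself, which is left to \<open>sim_App\<close>. Value answers lie in \<open>S\<close> while the
  substituted values are related by \<open>R\<close>; closure of \<open>V\<close>, which contains
  both, combines them.\<close>

lemma sim_subst:
  assumes H: "half_progress R S T" and sub: "R \<subseteq> T" "T \<subseteq> U" "R \<subseteq> V" "S \<subseteq> V" "strong_closed V"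
    and ts: "(t, s) \<in> R" and vw: "(v, w) \<in> val_ext R"
  shows "sim V U (t[x::=v]) (s[x::=w])"
proof -
  interpret V: strong_closed V by fact
  let ?\<sigma> = "Var(x := v)" and ?\<tau> = "Var(x := w)"
  have "R \<subseteq> U" using sub by simp
  have vwU: "(v, w) \<in> val_ext U" and vwV: "(v, w) \<in> val_ext V"
    using vw val_ext_mono[OF \<open>R \<subseteq> U\<close>] val_ext_mono[OF \<open>R \<subseteq> V\<close>] by auto
  have sim: "sim S T t s" if "(t, s) \<in> R" for t s
    using H that by (simp add: half_progress_iff)
  from sim[OF ts] show ?thesis
  proof cases
    case (red t' s')
    then show ?thesis
      using step_psubst[OF red(1)] steps_psubst[OF red(2)] substI[OF _ vwU] sub by (blast intro: sim.red)
  next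
    case (val u' u)
    then show ?thesis
      using V.val_ext_subst[OF _ vwV, of u u' x] val_ext_mono[OF \<open>S \<subseteq> V\<close>] steps_psubst[OF val(2), of ?\<tau>]
      by (auto intro: sim.val)
  next
    case (opn F' z u' F u)
    have FF: "(psubstc ?\<sigma> F, psubstc ?\<tau> F') \<in> ctx_ext U"
      and uu: "(psubstv ?\<sigma> u, psubstv ?\<tau> u') \<in> val_ext U"
      using opn(3,4) ctx_ext_mono[OF \<open>T \<subseteq> U\<close>] val_ext_mono[OF \<open>T \<subseteq> U\<close>] vwU
      by (auto intro!: ctx_ext_subst val_ext_subst)
    have s: "s[x::=w] \<leadsto>* plug (psubstc ?\<tau> F') (App (Val (?\<tau> z)) (Val (psubstv ?\<tau> u')))"
      using steps_psubst[OF opn(2), of ?\<tau>] by (simp add: psubst_plug)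
    have t: "t[x::=v] = plug (psubstc ?\<sigma> F) (App (Val (?\<sigma> z)) (Val (psubstv ?\<sigma> u)))"
      by (simp add: opn psubst_plug)
    show ?thesis
    proof (cases "z = x")
      case False
      with s t FF uu show ?thesis by (auto intro: sim.opn)
    next
      case True
      \<comment> \<open>The head \<open>x\<close> turns into \<open>v\<close> on one side and
        \<open>w\<close> on the other. Their test is a pair of \<open>R\<close>, so progress of
        \<open>R\<close> is used a second time.\<close>
      from vw obtain y where y: "y \<notin> fvv v \<union> fvv w"
        and "(App (Val v) (tvar y), App (Val w) (tvar y)) \<in> R"
        by (auto simp: val_ext_def)
      from sim_App[OF sim[OF this(2)] \<open>T \<subseteq> U\<close> y FF uu, of V] s t True
      show ?thesis by (auto intro: sim_backward)
    qed
  next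
    case (ctrl E' u' E u)
    have "(psubstc ?\<sigma> E, psubstc ?\<tau> E') \<in> ctx_ext U"
      using ctrl(5) ctx_ext_mono[OF \<open>T \<subseteq> U\<close>] vwU by (auto intro!: ctx_ext_subst)
    moreover have "ctx_rel U (CReset (CAppR (psubstv ?\<sigma> u) Hole)) (CReset (CAppR (psubstv ?\<tau> u') Hole))"
      using ctx_rel_subst[OF ctx_rel_mono[OF ctrl(6) \<open>T \<subseteq> U\<close>] vwU] by simp
    moreover have "s[x::=w] \<leadsto>* plug (psubstc ?\<tau> E') (App (Val Shift) (Val (psubstv ?\<tau> u')))"
      using steps_psubst[OF ctrl(2), of ?\<tau>] by (simp add: psubst_plug)
    ultimately show ?thesis unfolding ctrl(1) by (simp add: psubst_plug sim_Shift)
  qed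
qed

text \<open>Substitution needs the values to be related in \<open>R\<close> itself; hence \<open>S = R\<close> is required here.\<close>

lemma sim_plug_val:
  assumes H: "half_progress R R T" and sub: "R \<subseteq> T" "T \<subseteq> U" "R \<subseteq> V" "strong_closed V"
    and F: "ctx_rel R F F'" and vw: "(v, w) \<in> val_ext R"
  shows "sim V U (plug F (Val v)) (plug F' (Val w))"
proof -
  obtain x where "x \<notin> fvc F \<union> fvc F'" "(plug F (tvar x), plug F' (tvar x)) \<in> R"
    using F by (auto simp: ctx_rel_def)
  with sim_subst[OF H sub(1,2,3,3,4) _ vw, of "plug F (tvar x)" "plug F' (tvar x)" x] show ?thesis
    by (simp add: psubst_plug psubstc_fresh)
qed

text \<open>The test in \<open>R\<close> serves a value answer, where plugging is a substitution
  into that test; the relation in \<open>U\<close> serves the other answers, where the contexts are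
  kept or composed.\<close>

lemma sim_ctx_ext:
  assumes H: "half_progress R R T" and sub: "R \<subseteq> T" "T \<subseteq> U" "R \<subseteq> V" "strong_closed V"
    and F: "ctx_rel R F F'" "(F, F') \<in> ctx_ext U" and ts: "(t, s) \<in> R"
  shows "sim V U (plug F t) (plug F' s)"
proof -
  have "sim R T t s" using H ts by (simp add: half_progress_iff)
  then show ?thesis
  proof cases
    case (red t' s')
    then show ?thesis
      using step_plug steps_plug ctx_extI[OF F(2)] \<open>T \<subseteq> U\<close> by (blast intro: sim.red)
  next
    case (val w v)
    then show ?thesis
      using sim_plug_val[OF H sub F(1)] steps_plug[OF val(2)] by (auto intro: sim_backward)
  next
    case (opn G' z u' G u)
    then have "(ccomp F G, ccomp F' G') \<in> ctx_ext U" "(u, u') \<in> val_ext U"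
      using ctx_ext_mono[OF \<open>T \<subseteq> U\<close>] val_ext_mono[OF \<open>T \<subseteq> U\<close>] F(2)
      by (auto intro!: ctx_ext_ccomp)
    with sim.opn[of "plug F' s" "ccomp F' G'" z u' "ccomp F G" U u V] steps_plug[OF opn(2), of F']
    show ?thesis by (simp add: opn(1))
  next
    case (ctrl E' u' E u)
    then have "(ccomp F E, ccomp F' E') \<in> ctx_ext U"
      using ctx_ext_mono[OF \<open>T \<subseteq> U\<close>] F(2) by (auto intro!: ctx_ext_ccomp)
    with sim_Shift[of "ccomp F E" "ccomp F' E'" u u' "plug F' s" V] steps_plug[OF ctrl(2), of F']
      ctx_rel_mono[OF ctrl(6) \<open>T \<subseteq> U\<close>]
    show ?thesis by (simp add: ctrl(1))
  qed
qed

lemma pure_trm_step: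
  assumes "t \<leadsto> t'" "pure_trm t"
  shows "pure_trm t'"
proof -
  \<comment> \<open>A context that yields a pure term is empty or begins with a reset, and in the
    latter case any filling is pure.\<close>
  have *: "pure_trm (plug F r')" if "pure_trm (plug F r)" "pure_trm r \<Longrightarrow> pure_trm r'" for F r r'
    using that by (cases F) (auto simp: pure_trm_def)
  from assms(1) show ?thesis
  proof cases
    case (beta F x t v)
    show ?thesis using assms(2) unfolding beta by (rule *) (simp add: pure_trm_def)
  next
    case (shift E x F v)
    show ?thesis using assms(2) unfolding shift by (rule *) (simp add: pure_trm_def)
  next
    case (reset F v)
    show ?thesis using assms(2) unfolding reset by (rule *) (simp add: pure_trm_def)
  qed
qed

lemma pure_trm_steps: "t \<leadsto>* t' \<Longrightarrow> pure_trm t \<Longrightarrow> pure_trm t'"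
  by (induct rule: rtranclp_induct) (auto intro: pure_trm_step)

text \<open>A pure term that is stuck on a variable is so below a reset, and it cannot be stuck on a
  shift. Purity therefore passes to the part of the stuck context outside the innermost reset, and
  \<open>ectxpure\<close> can compose it with \<open>F\<close>.\<close>

lemma sim_ectxpure:
  assumes H: "half_progress R R T" and sub: "R \<subseteq> T" "T \<subseteq> U" "R \<subseteq> V" "strong_closed V"
    and F: "ctx_rel R F F'" and ts: "(t, s) \<in> R" and pure: "pure_trm t" "pure_trm s"
  shows "sim V U (plug F t) (plug F' s)"
proof -
  have FU: "ctx_rel U F F'" using F sub by (blast intro: ctx_rel_mono)
  have "sim R T t s" using H ts by (simp add: half_progress_iff)
  then show ?thesis
  proof cases
    case (red t' s')
    then have "(plug F t', plug F' s') \<in> U"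
      using pure pure_trm_step pure_trm_steps FU \<open>T \<subseteq> U\<close> by (intro ectxpureI) auto
    then show ?thesis
      using step_plug[OF red(1)] steps_plug[OF red(2)] by (blast intro: sim.red)
  next
    case (val w v)
    then show ?thesis
      using sim_plug_val[OF H sub F] steps_plug[OF val(2)] by (auto intro: sim_backward)
  next
    case (opn G' z u' G u)
    have pure': "pure_trm (plug G' (App (tvar z) (Val u')))"
      using opn(2) pure(2) by (rule pure_trm_steps)
    have "(G, G') \<in> ctx_ext U" using opn(3) ctx_ext_mono[OF \<open>T \<subseteq> U\<close>] by blast
    then have "(ccomp F G, ccomp F' G') \<in> ctx_ext U"
    proof (cases rule: ctx_ext_cases)
      case pure
      with \<open>pure_trm t\<close> opn(1) show ?thesis by (cases G) (auto simp: pure_trm_def)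
    next
      case (impure H E H' E')
      \<comment> \<open>The outer part \<open>D\<close> is empty, giving a variable, or begins with
        a reset.\<close>
      have *: "pure_trm (plug D (tvar y))" if "pure_trm (plug (ccomp D (CReset E)) r)" for D E y r
        using that by (cases D) (auto simp: pure_trm_def)
      have "pure_trm (plug H (tvar y))" "pure_trm (plug H' (tvar y))" for y
        using *[of H E] *[of H' E'] pure(1) pure' unfolding opn(1) impure(1,2) by blast+
      then have "ctx_rel U (ccomp F H) (ccomp F' H')"
        using impure FU by (intro ctx_relI) (simp add: ectxpureI ctx_relD)
      then show ?thesis
        using impure ctx_ext_impure[of "ccomp F H" "ccomp F' H'" E E'] by (simp add: ccomp_assoc)
    qed
    moreover have "(u, u') \<in> val_ext U" using opn(4) val_ext_mono[OF \<open>T \<subseteq> U\<close>] by blast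
    ultimately show ?thesis
      using sim.opn[of "plug F' s" "ccomp F' G'" z u' "ccomp F G" U u V] steps_plug[OF opn(2), of F']
      by (simp add: opn(1))
  next
    case (ctrl E' u' E u)
    with pure(1) show ?thesis by (cases E) (auto simp: pure_trm_def)
  qed
qed

end

lemma (in strong_closed) sim_refl:
  assumes "strong_closed V"
  shows "sim V U t t"
proof -
  interpret V: strong_closed V by fact
  show ?thesis
  proof (cases t rule: trm_cases)
    case (red t')
    then show ?thesis by (intro sim.red[OF _ _ reflI]) auto
  next
    case (val v)
    then show ?thesis using sim.val[OF _ V.val_ext_refl] by simp
  next
    case (opn F x v)
    then show ?thesis using sim.opn[OF _ ctx_ext_refl val_ext_refl] by simp
  next
    case (ctrl E v)
    then show ?thesis using sim.ctrl[OF _ _ _ ctx_ext_refl ctx_rel_refl] by simp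
  qed
qed

text \<open>If \<open>t\<close> takes a first step towards \<open>t'\<close>, its reduct and
  \<open>s\<close> still reduce to a pair in \<open>U\<close>; if there is no such step, only
  \<open>s\<close> is expanded.\<close>

lemma (in strong_closed) sim_red:
  assumes "t \<leadsto>* t'" "s \<leadsto>* s'" "(t', s') \<in> U" "sim V U t' s'"
  shows "sim V U t s"
  using assms(1)
proof (cases rule: converse_rtranclpE)
  case base
  with assms show ?thesis by (simp add: sim_backward)
next
  case (step t1)
  then show ?thesis using assms(2,3) by (blast intro: sim.red redI)
qed


section \<open>Continuity, monotonicity and symmetry of the up-to techniques\<close>

lemma continuous_funI:
  assumes "\<And>R p. p \<in> f R \<Longrightarrow> \<exists>A\<subseteq>R. finite A \<and> p \<in> f A"
  shows "continuous_fun f"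
  unfolding continuous_fun_def
proof (intro allI subsetI)
  fix R p assume "p \<in> f R"
  from assms[OF this] show "p \<in> \<Union> {f S | S. S \<subseteq> R \<and> finite S}" by blast
qed

lemma ctx_rel_finite: "ctx_rel R F F' \<Longrightarrow> \<exists>p\<in>R. ctx_rel {p} F F'"
  unfolding ctx_rel_def by blast

text \<open>A pure pair of contexts rests on one tested pair of \<open>R\<close>, an impure one on
  two.\<close>

lemma ctx_ext_finite:
  assumes "(F, F') \<in> ctx_ext R"
  shows "\<exists>A\<subseteq>R. finite A \<and> (F, F') \<in> ctx_ext A"
  using assms
proof (cases rule: ctx_ext.cases)
  case (pure x)
  then show ?thesis
    by (intro exI[of _ "{(plug F (tvar x), plug F' (tvar x))}"]) (auto intro: ctx_ext.pure)
next
  case (impure E E' x G G')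
  then show ?thesis
    by (intro exI[of _ "{(Reset (plug E (tvar x)), Reset (plug E' (tvar x))),
      (plug G (tvar x), plug G' (tvar x))}"]) (auto intro: ctx_ext.impure)
qed

lemma continuous_refl: "continuous_fun upto_refl"
  by (rule continuous_funI) (auto simp: upto_refl_def)

lemma continuous_lam: "continuous_fun upto_lam"
proof (rule continuous_funI)
  fix R p assume "p \<in> upto_lam R"
  then obtain x t s where "p = (Val (LAM x t), Val (LAM x s))" "(t, s) \<in> R"
    by (auto simp: upto_lam_def)
  then show "\<exists>A\<subseteq>R. finite A \<and> p \<in> upto_lam A"
    by (intro exI[of _ "{(t, s)}"]) (auto simp: upto_lam_def)
qed

lemma continuous_subst: "continuous_fun upto_subst"
proof (rule continuous_funI)
  fix R p assume "p \<in> upto_subst R"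
  then obtain t s x v w where p: "p = (t[x::=v], s[x::=w])" "(t, s) \<in> R" "(v, w) \<in> val_ext R"
    unfolding upto_subst_def by blast
  then obtain q where "q \<in> R" "(v, w) \<in> val_ext {q}"
    using ctx_rel_finite unfolding val_ext_iff by blast
  moreover from this have "(v, w) \<in> val_ext {(t, s), q}"
    using val_ext_mono[of "{q}" "{(t, s), q}"] by blast
  then have "p \<in> upto_subst {(t, s), q}"
    unfolding upto_subst_def p(1) by blast
  ultimately show "\<exists>A\<subseteq>R. finite A \<and> p \<in> upto_subst A"
    using p(2) by (intro exI[of _ "{(t, s), q}"]) simp
qed

lemma continuous_red: "continuous_fun upto_red"
proof (rule continuous_funI)
  fix R p assume "p \<in> upto_red R"
  then obtain t s t' s' where "p = (t, s)" "t \<leadsto>* t'" "s \<leadsto>* s'" "(t', s') \<in> R"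
    by (auto simp: upto_red_def)
  then show "\<exists>A\<subseteq>R. finite A \<and> p \<in> upto_red A"
    by (intro exI[of _ "{(t', s')}"]) (auto simp: upto_red_def)
qed

lemma continuous_pctx: "continuous_fun upto_pctx"
proof (rule continuous_funI)
  fix R p assume "p \<in> upto_pctx R"
  then obtain E E' t s where p: "p = (plug E t, plug E' s)" "(t, s) \<in> R" "pure_ctx E" "pure_ctx E'"
    and E: "(E, E') \<in> ctx_ext R"
    unfolding upto_pctx_def by blast
  from ctx_ext_finite[OF E] obtain A where A: "A \<subseteq> R" "finite A" "(E, E') \<in> ctx_ext A"
    by blast
  then have "(E, E') \<in> ctx_ext (insert (t, s) A)"
    using ctx_ext_mono[of A "insert (t, s) A"] by blast
  then have "p \<in> upto_pctx (insert (t, s) A)"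
    using p unfolding upto_pctx_def by blast
  with A p(2) show "\<exists>A\<subseteq>R. finite A \<and> p \<in> upto_pctx A"
    by (intro exI[of _ "insert (t, s) A"]) simp
qed

lemma continuous_pctxrst: "continuous_fun upto_pctxrst"
proof (rule continuous_funI)
  fix R p assume "p \<in> upto_pctxrst R"
  then obtain E E' t s where p: "p = (Reset (plug E t), Reset (plug E' s))" "(t, s) \<in> R"
      "pure_ctx E" "pure_ctx E'"
    and E: "(CReset E, CReset E') \<in> ctx_ext R"
    unfolding upto_pctxrst_def by blast
  from ctx_ext_finite[OF E] obtain A
    where A: "A \<subseteq> R" "finite A" "(CReset E, CReset E') \<in> ctx_ext A"
    by blast
  then have "(CReset E, CReset E') \<in> ctx_ext (insert (t, s) A)"
    using ctx_ext_mono[of A "insert (t, s) A"] by blast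
  then have "p \<in> upto_pctxrst (insert (t, s) A)"
    using p unfolding upto_pctxrst_def by blast
  with A p(2) show "\<exists>A\<subseteq>R. finite A \<and> p \<in> upto_pctxrst A"
    by (intro exI[of _ "insert (t, s) A"]) simp
qed

lemma upto_ectxpure_iff: "upto_ectxpure R =
  {(plug F t, plug F' s) | F F' t s. (t, s) \<in> R \<and> pure_trm t \<and> pure_trm s \<and> ctx_rel R F F'}"
  by (simp add: upto_ectxpure_def ctx_rel_def)

lemma continuous_ectxpure: "continuous_fun upto_ectxpure"
proof (rule continuous_funI)
  fix R p assume "p \<in> upto_ectxpure R"
  then obtain F F' t s where p: "p = (plug F t, plug F' s)" "(t, s) \<in> R" "pure_trm t" "pure_trm s"
    and "ctx_rel R F F'"
    unfolding upto_ectxpure_iff by blast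
  then obtain q where "q \<in> R" "ctx_rel {q} F F'"
    using ctx_rel_finite by blast
  moreover from this have "ctx_rel {(t, s), q} F F'"
    using ctx_rel_mono[of "{q}" F F' "{(t, s), q}"] by blast
  then have "p \<in> upto_ectxpure {(t, s), q}"
    using p unfolding upto_ectxpure_iff by blast
  ultimately show "\<exists>A\<subseteq>R. finite A \<and> p \<in> upto_ectxpure A"
    using p(2) by (intro exI[of _ "{(t, s), q}"]) simp
qed

lemma continuous_id: "continuous_fun id"
  by (rule continuous_funI) auto

definition strong_techniques :: "rfun set" where
  "strong_techniques = {upto_refl, upto_lam, upto_subst, id, upto_red}"

definition weak_techniques :: "rfun set" where
  "weak_techniques = {upto_pctx, upto_pctxrst, upto_ectxpure}"

abbreviation "techniques \<equiv> strong_techniques \<union> weak_techniques"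

lemma continuous_techniques: "f \<in> techniques \<Longrightarrow> continuous_fun f"
  unfolding strong_techniques_def weak_techniques_def
  using continuous_refl continuous_lam continuous_subst continuous_id continuous_red
    continuous_pctx continuous_pctxrst continuous_ectxpure by blast

lemma mono_techniques:
  assumes "f \<in> techniques"
  shows "mono f"
proof (rule monoI)
  fix R S :: trel assume RS: "R \<subseteq> S"
  have "upto_refl R \<subseteq> upto_refl S" "upto_lam R \<subseteq> upto_lam S" "upto_red R \<subseteq> upto_red S"
    using RS by (auto simp: upto_refl_def upto_lam_def upto_red_def)
  moreover have "upto_subst R \<subseteq> upto_subst S"
    using RS val_ext_mono[OF RS] unfolding upto_subst_def by blast
  moreover have "upto_pctx R \<subseteq> upto_pctx S" "upto_pctxrst R \<subseteq> upto_pctxrst S"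
    using RS ctx_ext_mono[OF RS] unfolding upto_pctx_def upto_pctxrst_def by blast+
  moreover have "upto_ectxpure R \<subseteq> upto_ectxpure S"
    using RS ctx_rel_mono[OF _ RS] unfolding upto_ectxpure_iff by blast
  ultimately show "f R \<subseteq> f S"
    using assms RS unfolding strong_techniques_def weak_techniques_def by auto
qed

section \<open>Symmetry under converse\<close>

lemma ctx_rel_converse: "ctx_rel (R\<inverse>) F F' \<longleftrightarrow> ctx_rel R F' F"
  unfolding ctx_rel_def by auto

lemma val_ext_converse: "(v, w) \<in> val_ext (R\<inverse>) \<longleftrightarrow> (w, v) \<in> val_ext R"
  by (simp add: val_ext_iff ctx_rel_converse)

lemma ctx_ext_converse: "(F, F') \<in> ctx_ext (R\<inverse>) \<longleftrightarrow> (F', F) \<in> ctx_ext R"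
proof -
  have "(F', F) \<in> ctx_ext (R\<inverse>)" if "(F, F') \<in> ctx_ext R" for F F' R
    using that
  proof cases
    case (pure x)
    then show ?thesis by (auto intro: ctx_ext.pure)
  next
    case (impure E E' x G G')
    then show ?thesis by (auto intro: ctx_ext.impure)
  qed
  from this[of F F' "R\<inverse>"] this[of F' F R] show ?thesis by auto
qed

text \<open>Reduces the second half of progress to the first one, applied to the converse
  relations.\<close>

lemma techniques_converse:
  assumes "f \<in> techniques"
  shows "f (R\<inverse>) = (f R)\<inverse>"
proof -
  have "upto_refl (R\<inverse>) = (upto_refl R)\<inverse>" "upto_lam (R\<inverse>) = (upto_lam R)\<inverse>"
    "upto_red (R\<inverse>) = (upto_red R)\<inverse>"
    by (auto simp: upto_refl_def upto_lam_def upto_red_def)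
  moreover have "upto_subst (R\<inverse>) = (upto_subst R)\<inverse>"
    unfolding upto_subst_def val_ext_converse by blast
  moreover have "upto_pctx (R\<inverse>) = (upto_pctx R)\<inverse>" "upto_pctxrst (R\<inverse>) = (upto_pctxrst R)\<inverse>"
    unfolding upto_pctx_def upto_pctxrst_def ctx_ext_converse by blast+
  moreover have "upto_ectxpure (R\<inverse>) = (upto_ectxpure R)\<inverse>"
    unfolding upto_ectxpure_iff ctx_rel_converse by blast
  ultimately show ?thesis
    using assms unfolding strong_techniques_def weak_techniques_def by auto
qed

lemma closed_converse: "f \<in> techniques \<Longrightarrow> f (U\<inverse>) \<subseteq> U\<inverse> \<longleftrightarrow> f U \<subseteq> U"
  by (simp add: techniques_converse)

lemma strong_closed_converse: "strong_closed U \<Longrightarrow> strong_closed (U\<inverse>)"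
  unfolding strong_closed_def by (simp add: closed_converse strong_techniques_def)

lemma full_closed_converse: "full_closed U \<Longrightarrow> full_closed (U\<inverse>)"
  unfolding full_closed_def full_closed_axioms_def
  by (simp add: closed_converse strong_closed_converse weak_techniques_def)

section \<open>Iterated closures as least closed relations\<close>

lemma omega_iff: "p \<in> omega f R \<longleftrightarrow> (\<exists>n. p \<in> (f ^^ n) R)"
  by (simp add: omega_def)

lemma subset_omega: "R \<subseteq> omega f R"
proof
  fix p assume "p \<in> R"
  then have "p \<in> (f ^^ 0) R" by simp
  then show "p \<in> omega f R" unfolding omega_iff by blast
qed

lemma hat_Sup: "hat (Sup G) R = (\<Union>f\<in>G. f R) \<union> R"
  by (simp add: hat_def)

text \<open>Continuity makes one iteration past all finite stages superfluous.\<close>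

lemma omega_closed:
  assumes f: "f \<in> G" "mono f" "continuous_fun f"
  shows "f (omega (hat (Sup G)) R) \<subseteq> omega (hat (Sup G)) R"
proof
  let ?h = "hat (Sup G)"
  fix p assume "p \<in> f (omega ?h R)"
  then obtain A where A: "A \<subseteq> omega ?h R" "finite A" "p \<in> f A"
    using f(3) unfolding continuous_fun_def by blast
  have inc: "(?h ^^ m) R \<subseteq> (?h ^^ n) R" if "m \<le> n" for m n
    using that
  proof (induct rule: dec_induct)
    case (step n)
    have "(?h ^^ n) R \<subseteq> (?h ^^ Suc n) R"
      unfolding funpow.simps o_apply by (subst hat_Sup) (rule Un_upper2)
    with step(3) show ?case by (rule subset_trans)
  qed simp
  \<comment> \<open>The stages increase since \<open>hat\<close> adds the identity; so a finite
    subset of their union lies in a single stage.\<close>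
  from A(2,1) have "\<exists>n. A \<subseteq> (?h ^^ n) R"
  proof (induct A)
    case (insert a A)
    then obtain m where m: "A \<subseteq> (?h ^^ m) R" unfolding insert_subset by iprover
    from insert.prems have "a \<in> omega ?h R" unfolding insert_subset ..
    then obtain n where n: "a \<in> (?h ^^ n) R" unfolding omega_iff ..
    have "A \<subseteq> (?h ^^ max m n) R" "a \<in> (?h ^^ max m n) R"
      by (rule subset_trans[OF m], rule inc, simp) (rule subsetD[OF inc n], simp)
    then have "insert a A \<subseteq> (?h ^^ max m n) R" by (simp only: insert_subset)
    then show ?case ..
  qed simp
  then obtain n where n: "A \<subseteq> (?h ^^ n) R" ..
  have "p \<in> ?h ((?h ^^ n) R)"
    by (subst hat_Sup) (rule UnI1, rule UN_I[OF f(1)],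
      rule subsetD[OF monoD[OF f(2) n] A(3)])
  then have "p \<in> (?h ^^ Suc n) R" by (simp only: funpow.simps o_apply)
  then show "p \<in> omega ?h R" unfolding omega_iff ..
qed

text \<open>Together with \<open>omega_closed\<close> this makes the iteration the least relation
  above \<open>R\<close> that is closed under \<open>G\<close>, for monotone and continuous
  members.\<close>

lemma omega_least:
  assumes "R \<subseteq> U" "\<And>f. f \<in> G \<Longrightarrow> mono f" "\<And>f. f \<in> G \<Longrightarrow> f U \<subseteq> U"
  shows "omega (hat (Sup G)) R \<subseteq> U"
proof -
  have "(hat (Sup G) ^^ n) R \<subseteq> U" for n
  proof (induct n)
    case (Suc n)
    have "f ((hat (Sup G) ^^ n) R) \<subseteq> U" if "f \<in> G" for f
      using monoD[OF assms(2)[OF that] Suc] assms(3)[OF that] by (rule subset_trans)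
    then have "hat (Sup G) ((hat (Sup G) ^^ n) R) \<subseteq> U"
      using Suc by (subst hat_Sup) (intro Un_least UN_least)
    then show ?case by (simp only: funpow.simps o_apply)
  next
    case 0
    show ?case using assms(1) by simp
  qed
  then show ?thesis unfolding omega_def SUP_apply by (rule SUP_least)
qed

abbreviation "strong_closure \<equiv> omega (hat (Sup strong_techniques))"
abbreviation "full_closure \<equiv> omega (hat (Sup techniques))"

lemma strong_closure_closed:
  assumes "f \<in> strong_techniques"
  shows "f (strong_closure R) \<subseteq> strong_closure R"
  using assms omega_closed[OF assms mono_techniques continuous_techniques] by blast

lemma full_closure_closed:
  assumes "f \<in> techniques"
  shows "f (full_closure R) \<subseteq> full_closure R"
  using assms omega_closed[OF assms mono_techniques continuous_techniques] by blast

lemma strong_closed_strong_closure: "strong_closed (strong_closure R)"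
  unfolding strong_closed_def
  by (intro conjI strong_closure_closed) (simp_all add: strong_techniques_def)

lemma full_closed_full_closure: "full_closed (full_closure R)"
  unfolding full_closed_def full_closed_axioms_def strong_closed_def
  by (intro conjI full_closure_closed) (simp_all add: strong_techniques_def weak_techniques_def)

lemma strong_closure_least: "R \<subseteq> full_closure T \<Longrightarrow> strong_closure R \<subseteq> full_closure T"
  using mono_techniques full_closure_closed by (intro omega_least) blast+


section \<open>Evolution of the up-to techniques\<close>

context full_closed
begin

lemma half_progress_strong:
  assumes H: "half_progress R S T" and sub: "R \<subseteq> T" "T \<subseteq> U" "R \<subseteq> V" "S \<subseteq> V" "strong_closed V"
    and f: "f \<in> strong_techniques"
  shows "half_progress (f R) V U"
  unfolding half_progress_iff
proof (intro allI impI)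
  fix t s assume ts: "(t, s) \<in> f R"
  interpret V: strong_closed V by fact
  have sim: "sim V U t s" if "(t, s) \<in> R" for t s
    using H that sim_mono[OF _ \<open>S \<subseteq> V\<close> \<open>T \<subseteq> U\<close>] by (simp add: half_progress_iff)
  from f consider "f = upto_refl" | "f = upto_lam" | "f = upto_subst" | "f = id" | "f = upto_red"
    by (auto simp: strong_techniques_def)
  then show "sim V U t s"
  proof cases
    case 1
    with ts have "t = s" by (simp add: upto_refl_def)
    then show ?thesis by (simp add: sim_refl sub)
  next
    case 2
    with ts obtain x t' s' where lam: "t = Val (LAM x t')" "s = Val (LAM x s')" "(t', s') \<in> V"
      using sub by (auto simp: upto_lam_def)
    \<comment> \<open>Abstractions are already values, so the answer is the pair itself; the bodies,
      related in \<open>R\<close> and hence in \<open>V\<close>, provide its value test.\<close>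
    show ?thesis unfolding lam(1,2)
      by (rule sim.val[OF rtranclp.rtrancl_refl V.LAM_val_ext[OF lam(3)]])
  next
    case 3
    with ts have "(t, s) \<in> upto_subst R" by simp
    then obtain t' s' x v w where "t = t'[x::=v]" "s = s'[x::=w]" "(t', s') \<in> R" "(v, w) \<in> val_ext R"
      unfolding upto_subst_def by blast
    then show ?thesis using sim_subst[OF H sub] by blast
  next
    case 4
    with ts sim show ?thesis by simp
  next
    case 5
    with ts obtain t' s' where r: "t \<leadsto>* t'" "s \<leadsto>* s'" "(t', s') \<in> R"
      by (auto simp: upto_red_def)
    then have "(t', s') \<in> U" using sub by blast
    from sim_red[OF r(1,2) this sim[OF r(3)]] show ?thesis .
  qed
qed

lemma half_progress_weak:
  assumes H: "half_progress R R T" and sub: "R \<subseteq> T" "T \<subseteq> U" "R \<subseteq> V" "strong_closed V"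
    and f: "f \<in> weak_techniques"
  shows "half_progress (f R) V U"
  unfolding half_progress_iff
proof (intro allI impI)
  fix t s assume ts: "(t, s) \<in> f R"
  have RU: "ctx_ext R \<subseteq> ctx_ext U" using sub by (intro ctx_ext_mono) blast
  from f consider "f = upto_pctx" | "f = upto_pctxrst" | "f = upto_ectxpure"
    by (auto simp: weak_techniques_def)
  then show "sim V U t s"
  proof cases
    case 1
    with ts have "(t, s) \<in> upto_pctx R" by simp
    then obtain E E' t' s' where E: "t = plug E t'" "s = plug E' s'" "(t', s') \<in> R"
        "pure_ctx E" "pure_ctx E'" "(E, E') \<in> ctx_ext R"
      unfolding upto_pctx_def by blast
    from E(6) have "ctx_rel R E E'"
      by (cases rule: ctx_ext_cases) (use E in auto)
    from sim_ctx_ext[OF H sub this subsetD[OF RU E(6)] E(3)] E(1,2) show ?thesis by simp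
  next
    case 2
    with ts have "(t, s) \<in> upto_pctxrst R" by simp
    then obtain E E' t' s' where E: "t = Reset (plug E t')" "s = Reset (plug E' s')" "(t', s') \<in> R"
        "pure_ctx E" "pure_ctx E'" "(CReset E, CReset E') \<in> ctx_ext R"
      unfolding upto_pctxrst_def by blast
    show ?thesis
      using sim_ctx_ext[OF H sub ctx_ext_CReset[OF E(6,4,5)] subsetD[OF RU E(6)] E(3)] E(1,2) by simp
  next
    case 3
    with ts have "(t, s) \<in> upto_ectxpure R" by simp
    then obtain F F' t' s' where F: "t = plug F t'" "s = plug F' s'" "(t', s') \<in> R"
        "pure_trm t'" "pure_trm s'" "ctx_rel R F F'"
      unfolding upto_ectxpure_iff by blast
    from sim_ectxpure[OF H sub F(6,3,4,5)] F(1,2) show ?thesis by simp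
  qed
qed

end

lemma half_progress_mono: "half_progress R S T \<Longrightarrow> S \<subseteq> S' \<Longrightarrow> T \<subseteq> T' \<Longrightarrow> half_progress R S' T'"
  by (simp add: half_progress_iff sim_mono[of S T])

lemma strong_evolution:
  assumes f: "f \<in> strong_techniques"
  shows "strongly_evolves f strong_closure full_closure"
  unfolding strongly_evolves_def
proof (intro allI impI)
  fix R S T assume P: "progress R S T"
  define V where "V = strong_closure S"
  define U where "U = full_closure T"
  have V: "strong_closed V" unfolding V_def by (rule strong_closed_strong_closure)
  have U: "full_closed U" unfolding U_def by (rule full_closed_full_closure)
  have f': "f \<in> techniques" using f by simp
  have sub: "R \<subseteq> T" "T \<subseteq> U" "R \<subseteq> V" "S \<subseteq> V"
    using P subset_omega[of S] subset_omega[of T] unfolding progress_def V_def U_def by blast+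
  have H: "half_progress R S T" "half_progress (R\<inverse>) (S\<inverse>) (T\<inverse>)" "S \<subseteq> T"
    using P by (simp_all add: progress_def)
  have "f R \<subseteq> f V" using mono_techniques[OF f'] sub(3) by (rule monoD)
  also have "f V \<subseteq> V" unfolding V_def using f by (rule strong_closure_closed)
  finally have "f R \<subseteq> V" .
  moreover have "V \<subseteq> U"
    unfolding V_def U_def using H(3) sub(2) U_def by (intro strong_closure_least) blast
  moreover have "half_progress (f R) V U"
    by (rule full_closed.half_progress_strong[OF U H(1) sub V f])
  \<comment> \<open>The reverse direction: closures of converse relations are again closed, so the
    same lemma applies to the converses.\<close>
  moreover have "half_progress (f (R\<inverse>)) (V\<inverse>) (U\<inverse>)"
    by (rule full_closed.half_progress_strong[OF full_closed_converse[OF U] H(2) _ _ _ _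
          strong_closed_converse[OF V] f]) (use sub in simp_all)
  ultimately show "progress (f R) (strong_closure S) (full_closure T)"
    unfolding V_def[symmetric] U_def[symmetric]
    by (simp add: progress_def techniques_converse[OF f'])
qed

text \<open>The middle layer of \<open>W\<close> contributes the one use of \<open>f\<close> that
  puts \<open>f R\<close> below \<open>W\<close>. Value answers already lie in the innermost layer
  \<open>V\<close>, so they need only be weakened to \<open>W\<close>.\<close>

lemma weak_evolution:
  assumes f: "f \<in> techniques"
  shows "evolves f (strong_closure \<circ> hat (Sup techniques) \<circ> strong_closure) full_closure"
  unfolding evolves_def
proof (intro allI impI)
  fix R T assume P: "progress R R T"
  define V where "V = strong_closure R"
  define U where "U = full_closure T"
  define H where "H = hat (Sup techniques) V"
  define W where "W = strong_closure H"
  have V: "strong_closed V" unfolding V_def by (rule strong_closed_strong_closure)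
  have U: "full_closed U" unfolding U_def by (rule full_closed_full_closure)
  have sub: "R \<subseteq> T" "T \<subseteq> U" "R \<subseteq> V"
    using P subset_omega[of R] subset_omega[of T] unfolding progress_def V_def U_def by blast+
  have HP: "half_progress R R T" "half_progress (R\<inverse>) (R\<inverse>) (T\<inverse>)"
    using P by (simp_all add: progress_def)
  have H_eq: "H = (\<Union>g\<in>techniques. g V) \<union> V" unfolding H_def by (rule hat_Sup)
  have HW: "H \<subseteq> W" unfolding W_def by (rule subset_omega)
  have VW: "V \<subseteq> W" using HW unfolding H_eq by blast
  have VU: "V \<subseteq> U"
    unfolding V_def U_def using sub(1,2) U_def by (intro strong_closure_least) blast
  have "f R \<subseteq> f V" using mono_techniques[OF f] sub(3) by (rule monoD)
  then have "f R \<subseteq> W" using f HW unfolding H_eq by blast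
  moreover have "g V \<subseteq> U" if "g \<in> techniques" for g
  proof -
    have "g V \<subseteq> g U" using mono_techniques[OF that] VU by (rule monoD)
    also have "g U \<subseteq> U" unfolding U_def using that by (rule full_closure_closed)
    finally show ?thesis .
  qed
  then have "H \<subseteq> U" unfolding H_eq using VU by (intro Un_least UN_least)
  then have "W \<subseteq> U" unfolding W_def U_def by (rule strong_closure_least)
  moreover have "half_progress (f R) V U"
    using f full_closed.half_progress_strong[OF U HP(1) sub sub(3) V]
      full_closed.half_progress_weak[OF U HP(1) sub V] by (elim UnE)
  then have "half_progress (f R) W U"
    using VW by (rule half_progress_mono) simp
  moreover have "half_progress (f (R\<inverse>)) (V\<inverse>) (U\<inverse>)"
  proof -
    note U' = full_closed_converse[OF U] and V' = strong_closed_converse[OF V]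
    have sub': "R\<inverse> \<subseteq> T\<inverse>" "T\<inverse> \<subseteq> U\<inverse>" "R\<inverse> \<subseteq> V\<inverse>" using sub by simp_all
    show ?thesis
      using f full_closed.half_progress_strong[OF U' HP(2) sub' sub'(3) V']
        full_closed.half_progress_weak[OF U' HP(2) sub' V'] by (elim UnE)
  qed
  then have "half_progress (f (R\<inverse>)) (W\<inverse>) (U\<inverse>)"
    by (rule half_progress_mono) (use VW in simp_all)
  ultimately have "progress (f R) W U"
    by (simp add: progress_def techniques_converse[OF f])
  then show "progress (f R) ((strong_closure \<circ> hat (Sup techniques) \<circ> strong_closure) R)
      (full_closure T)"
    unfolding o_apply V_def[symmetric] H_def[symmetric] W_def[symmetric] U_def[symmetric] .
qed


section \<open>The weak techniques are not strong\<close>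

text \<open>The right term is irreducible, so the stuck answer can only be that term itself, and
  \<open>sim\<close> keeps the head variable.\<close>

lemma sim_open_same_head:
  assumes "sim S T (plug F (App (tvar y) (Val v))) (plug F' (App (tvar z) (Val w)))"
  shows "y = z"
  using assms
proof cases
  case (opn G' x u' G u)
  from opn(2) have "plug F' (App (tvar z) (Val w)) = plug G' (App (tvar x) (Val u'))"
    by (cases rule: converse_rtranclpE) (simp_all add: open_irreducible)
  with opn(1) show ?thesis by (simp add: plug_proto_eq_iff)
qed (simp_all add: open_irreducible plug_proto_eq_iff)

text \<open>Progress towards the total relation constrains only the shape of normal forms, so it may
  relate two distinct variables; plugging them into the context \<open>[] y\<close> yields differently stuck terms.\<close>

lemma weak_not_strongly_evolves:
  assumes "f \<in> weak_techniques"
  shows "\<not> strongly_evolves f g h"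
proof
  let ?xy = "App (tvar 0) (tvar 1)"
  \<comment> \<open>The first pair relates two distinct variables. The others are context tests with
    the fresh variable 0: \<open>?xy\<close> and its reset test \<open>E\<close>, and
    \<open>tvar 0\<close> tests the empty outer part of \<open>CReset E\<close>.\<close>
  define R where "R = {(tvar 1, tvar 2), (?xy, ?xy), (Reset ?xy, Reset ?xy), (tvar 0, tvar 0)}"
  define E where "E = CAppL Hole (tvar 1)"
  interpret total: strong_closed UNIV by standard simp_all
  have refl: "sim UNIV UNIV t t" for t
    by (rule total.sim_refl) (rule total.strong_closed_axioms)
  have vars: "sim UNIV UNIV (tvar y) (tvar z)" for y z
  proof (rule sim.val)
    have "Suc (y + z) \<notin> fvv (Var y) \<union> fvv (Var z)" by simp
    then show "(Var y, Var z) \<in> val_ext UNIV" unfolding val_ext_def by blast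
  qed simp
  have "sim UNIV UNIV t s \<and> sim UNIV UNIV s t" if "(t, s) \<in> R" for t s
    using that refl vars unfolding R_def by (elim insertE emptyE) simp_all
  then have "progress R UNIV UNIV"
    by (simp add: progress_def half_progress_iff)
  moreover assume "strongly_evolves f g h"
  ultimately have "progress (f R) (g UNIV) (h UNIV)"
    by (simp only: strongly_evolves_def)
  then have H: "half_progress (f R) (g UNIV) (h UNIV)"
    by (simp only: progress_def)
  have E: "pure_ctx E" and yz: "(tvar 1, tvar 2) \<in> R" by (simp_all add: E_def R_def)
  have "(E, E) \<in> ctx_ext R"
    by (rule ctx_ext.pure[where x = 0]) (simp_all add: E_def R_def)
  with E yz have pctx: "(plug E (tvar 1), plug E (tvar 2)) \<in> upto_pctx R"
    unfolding upto_pctx_def by blast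
  have "(CReset E, CReset E) \<in> ctx_ext R"
    using ctx_ext.impure[of E E 0 Hole Hole R] by (simp add: E_def R_def)
  with E yz have pctxrst: "(Reset (plug E (tvar 1)), Reset (plug E (tvar 2))) \<in> upto_pctxrst R"
    unfolding upto_pctxrst_def by blast
  have "ctx_rel R E E"
    unfolding ctx_rel_def by (rule exI[of _ 0]) (simp add: E_def R_def)
  moreover have "pure_trm (tvar 1)" "pure_trm (tvar 2)" by (simp_all add: pure_trm_def)
  ultimately have ectxpure: "(plug E (tvar 1), plug E (tvar 2)) \<in> upto_ectxpure R"
    unfolding upto_ectxpure_iff using yz
    by (intro CollectI exI[of _ E] exI[of _ "tvar 1"] exI[of _ "tvar 2"] conjI HOL.refl)
  \<comment> \<open>In each case \<open>f R\<close> relates two stuck terms with heads 1 and 2, for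
    \<open>upto_pctxrst\<close> below a reset.\<close>
  from assms have "(plug E (tvar 1), plug E (tvar 2)) \<in> f R
      \<or> (plug (CReset E) (tvar 1), plug (CReset E) (tvar 2)) \<in> f R"
    unfolding weak_techniques_def using pctx pctxrst ectxpure
    by (elim insertE emptyE) simp_all
  then have "sim (g UNIV) (h UNIV) (plug E (tvar 1)) (plug E (tvar 2)) \<or>
      sim (g UNIV) (h UNIV) (plug (CReset E) (tvar 1)) (plug (CReset E) (tvar 2))"
    using H by (auto simp only: half_progress_iff)
  then show False
    using sim_open_same_head[of _ _ Hole 1 "Var 1" Hole 2 "Var 1"]
      sim_open_same_head[of _ _ "CReset Hole" 1 "Var 1" "CReset Hole" 2 "Var 1"]
    by (auto simp: E_def)
qed

theorem theorem4p6:
  fixes \<F> :: "rfun set"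
  assumes "\<F> = {upto_refl, upto_lam, upto_subst, upto_pctx, upto_pctxrst, upto_ectxpure, id, upto_red}"
  shows "diacritically_compatible \<F> \<and>
         strong \<F> = \<F> - {upto_pctx, upto_pctxrst, upto_ectxpure}"
proof -
  have F: "\<F> = techniques"
    unfolding assms strong_techniques_def weak_techniques_def by blast
  have strong: "strong_subset strong_techniques \<F>"
    unfolding strong_subset_def F
    by (intro conjI ballI strong_evolution weak_evolution Un_upper1) assumption+
  have "diacritically_compatible \<F>"
    unfolding diacritically_compatible_def
  proof (intro conjI ballI)
    show "continuous_fun f" if "f \<in> \<F>" for f
      using that unfolding F by (rule continuous_techniques)
    show "\<exists>\<S>. strong_subset \<S> \<F>" using strong ..
  qed
  moreover have "strong \<F> = \<F> - weak_techniques"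
  proof (intro subset_antisym subsetI)
    fix f assume "f \<in> strong \<F>"
    then obtain \<S> where "strong_subset \<S> \<F>" "f \<in> \<S>" by (auto simp: strong_def)
    then have "f \<in> \<F>" "strongly_evolves f (omega (hat (Sup \<S>))) (omega (hat (Sup \<F>)))"
      by (auto simp only: strong_subset_def)
    \<comment> \<open>A weak technique strongly evolves to no pair of functions at all, so it is
      excluded from every \<open>\<S>\<close> in the union.\<close>
    with weak_not_strongly_evolves[of f "omega (hat (Sup \<S>))" "omega (hat (Sup \<F>))"]
    show "f \<in> \<F> - weak_techniques" by blast
  next
    fix f assume "f \<in> \<F> - weak_techniques"
    then have "f \<in> strong_techniques" unfolding F by blast
    with strong show "f \<in> strong \<F>" unfolding strong_def by (intro UnionI CollectI)
  qed
  ultimately show ?thesis by (simp add: weak_techniques_def)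
qed

end
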